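(* For all integers $m\ge 2$ and $n\ge 3$, \[\textup{aw}(P_m\square C_n,3)=\begin{cases}4 & \text{if $n$ is even and $\textup{diam}(P_m\square C_n)$ is odd,}\\ 3 & \text{otherwise.}\end{cases}\]
   Context: All graphs are finite, simple and undirected; $\textup{d}(u,v)$ denotes shortest-path distance and $\textup{diam}$ the diameter. $P_m$ is the path on $m$ vertices and $C_n$ the cycle on $n$ vertices. The Cartesian product $G\square H$ has vertex set $V(G)\times V(H)$, with $(x,y)$ adjacent to $(x',y')$ iff either $x=x'$ and $yy'\in E(H)$, or $y=y'$ and $xx'\in E(G)$. A 3-term arithmetic progression (3-AP) in a graph $G$ is a set of vertices $\{v_1,v_2,v_3\}$ (listed in some order) with $\textup{d}(v_1,v_2)=\textup{d}(v_2,v_3)$. An exact $r$-coloring of $G$ is a surjective map $c:V(G)\to\{1,\dots,r\}$; a set of vertices is rainbow under $c$ if its vertices receive pairwise distinct colors. The anti-van der Waerden number $\textup{aw}(G,3)$ is the least positive integer $r$ such that every exact $r$-coloring of $G$ contains a rainbow 3-AP; if no coloring of $V(G)$ yields a rainbow 3-AP, then $\textup{aw}(G,3)=|V(G)|+1$. *)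

theory Defs
  imports "Graph_Theory.Pair_Digraph" "Graph_Theory.Shortest_Path"
begin

text \<open>
  As in \<^theory>\<open>Graph_Theory.Digraph\<close>, an undirected graph is a symmetric digraph: each edge
  \<open>uv\<close> is represented by the two arcs \<open>(u, v)\<close> and \<open>(v, u)\<close>. Finite simple graphs are exactly the
  instances of \<^locale>\<open>pair_graph\<close>.
\<close>

definition path_graph :: "nat \<Rightarrow> nat pair_pre_digraph" where
  "path_graph m = \<lparr> pverts = {..<m},
     parcs = {(i, j). i < m \<and> j < m \<and> (j = i + 1 \<or> i = j + 1)} \<rparr>"

text \<open>The following is the cycle on \<open>n\<close> vertices for \<open>n \<ge> 3\<close>; it has loops for \<open>n = 1\<close>.\<close>

definition cycle_graph :: "nat \<Rightarrow> nat pair_pre_digraph" where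
  "cycle_graph n = \<lparr> pverts = {..<n},
     parcs = {(i, j). i < n \<and> j < n \<and> (j = (i + 1) mod n \<or> i = (j + 1) mod n)} \<rparr>"

definition cart_prod ::
  "'a pair_pre_digraph \<Rightarrow> 'b pair_pre_digraph \<Rightarrow> ('a \<times> 'b) pair_pre_digraph"
  (infixl \<open>\<box>\<close> 70) where
  "G \<box> H = \<lparr> pverts = pverts G \<times> pverts H,
     parcs = {((x, y), (x', y')).
       (x \<in> pverts G \<and> x = x' \<and> (y, y') \<in> parcs H) \<or>
       (y \<in> pverts H \<and> y = y' \<and> (x, x') \<in> parcs G)} \<rparr>"

text \<open>Shortest-path distance, i.e. every arc has cost 1; it is \<open>\<infinity>\<close> between different components.\<close>

definition gdist :: "'a pair_pre_digraph \<Rightarrow> 'a \<Rightarrow> 'a \<Rightarrow> ereal" where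
  "gdist G u v = wf_digraph.\<mu> (with_proj G) (\<lambda>_. 1) u v"

definition diam :: "'a pair_pre_digraph \<Rightarrow> ereal" where
  "diam G = (SUP (u, v) \<in> pverts G \<times> pverts G. gdist G u v)"

text \<open>
  The three vertices are required to be distinct. Degenerate progressions are thereby never rainbow,
  although a coloring is trivially injective on a singleton.
\<close>

definition is_3AP :: "'a pair_pre_digraph \<Rightarrow> 'a set \<Rightarrow> bool" where
  "is_3AP G S \<longleftrightarrow> (\<exists>v1 v2 v3. S = {v1, v2, v3} \<and> S \<subseteq> pverts G \<and> distinct [v1, v2, v3] \<and>
     gdist G v1 v2 = gdist G v2 v3)"

text \<open>The values of a coloring outside the vertex set are irrelevant.\<close>

definition exact_coloring :: "'a pair_pre_digraph \<Rightarrow> nat \<Rightarrow> ('a \<Rightarrow> nat) \<Rightarrow> bool" where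
  "exact_coloring G r c \<longleftrightarrow> c ` pverts G = {1..r}"

definition rainbow :: "('a \<Rightarrow> nat) \<Rightarrow> 'a set \<Rightarrow> bool" where
  "rainbow c S \<longleftrightarrow> inj_on c S"

definition has_rainbow_3AP :: "'a pair_pre_digraph \<Rightarrow> ('a \<Rightarrow> nat) \<Rightarrow> bool" where
  "has_rainbow_3AP G c \<longleftrightarrow> (\<exists>S. is_3AP G S \<and> rainbow c S)"

definition aw3 :: "'a pair_pre_digraph \<Rightarrow> nat" where
  "aw3 G = (if \<exists>r c. exact_coloring G r c \<and> has_rainbow_3AP G c
     then LEAST r. 0 < r \<and> (\<forall>c. exact_coloring G r c \<longrightarrow> has_rainbow_3AP G c)
     else card (pverts G) + 1)"

lemma pair_graph_path_graph: "pair_graph (path_graph m)"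
proof -
  have "finite (parcs (path_graph m))"
    by (rule finite_subset[of _ "{..<m} \<times> {..<m}"]) (auto simp: path_graph_def)
  then show ?thesis
    by unfold_locales (auto simp: path_graph_def symmetric_def intro!: symI)
qed

lemma pair_graph_cycle_graph:
  assumes "n \<ge> 3"
  shows "pair_graph (cycle_graph n)"
proof -
  have "finite (parcs (cycle_graph n))"
    by (rule finite_subset[of _ "{..<n} \<times> {..<n}"]) (auto simp: cycle_graph_def)
  moreover have "Suc i mod n \<noteq> i" if "i < n" for i
    using assms that by (simp add: mod_Suc)
  note this this[symmetric]
  ultimately show ?thesis
    by unfold_locales (auto simp: cycle_graph_def symmetric_def intro!: symI)
qed

lemma pair_graph_cart_prod:
  assumes "pair_graph G" "pair_graph H"
  shows "pair_graph (G \<box> H)"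
proof -
  interpret G: pair_graph G by fact
  interpret H: pair_graph H by fact
  have sub: "parcs (G \<box> H) \<subseteq> pverts (G \<box> H) \<times> pverts (G \<box> H)"
    using G.arc_fst_in_verts G.arc_snd_in_verts H.arc_fst_in_verts H.arc_snd_in_verts
    by (fastforce simp: cart_prod_def)
  have fin: "finite (pverts (G \<box> H))"
    by (simp add: cart_prod_def)
  have "finite (parcs (G \<box> H))"
    by (rule finite_subset[OF sub]) (simp add: fin)
  moreover have "sym (parcs G)" "sym (parcs H)"
    using G.sym_arcs H.sym_arcs by (simp_all add: symmetric_def)
  then have "symmetric (with_proj (G \<box> H))"
    by (auto simp: symmetric_def cart_prod_def sym_def)
  moreover have "fst e \<noteq> snd e" if "e \<in> parcs (G \<box> H)" for e
    using that G.pair_no_loops H.pair_no_loops by (fastforce simp: cart_prod_def)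
  ultimately show ?thesis
    using sub fin by unfold_locales auto
qed

end

theory Submission
  imports Defs
begin

text \<open>
  A coloring without rainbow 3-APs takes at most one color other than that of \<open>v\<close> on each sphere around
  \<open>v\<close>. Consider such a coloring with exactly the colors \<open>R\<close>, \<open>G\<close>, \<open>W\<close>.

  If all three kinds of bichromatic edges occur, choose an edge \<open>uv\<close> colored \<open>R\<close>, \<open>G\<close> and a vertex \<open>w\<close>
  colored \<open>W\<close> at the least possible distance \<open>k\<close> from \<open>v\<close>; then \<open>d(u,w) = k + 1\<close>. Every vertex at
  distance \<open>k\<close> from \<open>v\<close> and \<open>k + 1\<close> from \<open>u\<close> is again \<open>W\<close>, and comparing the spheres around two such
  vertices gives a contradiction, unless \<open>u\<close> and \<open>w\<close> are antipodal; in that case \<open>w\<close> is the only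
  vertex colored \<open>W\<close>, and it has neighbors of both other colors, which is impossible.

  Otherwise some two colors, say \<open>R\<close> and \<open>G\<close>, are never adjacent. Let \<open>k\<close> be the least distance between
  them, attained by \<open>u\<close> and \<open>v\<close>. The midpoint of a geodesic shows that \<open>k\<close> is odd. A vertex at distance
  \<open>k\<close> from \<open>u\<close> and less than \<open>k\<close> from \<open>v\<close> must be \<open>G\<close>, and symmetrically. These forced vertices come too
  close to each other unless \<open>n\<close> is even and \<open>k\<close> is the diameter, and then \<open>R\<close> and \<open>G\<close> occur only once
  because antipodes are unique. Coloring two antipodes and the remaining vertices with three colors shows
  that this case occurs. A coloring with four colors can be merged in two ways into one with
  three colors, so all four colors would occur only once.
\<close>

section \<open>Colorings of a strip\<close>

text \<open>The distance from 0 to the residue class of \<open>j\<close> on the cycle of length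
  \<open>n\<close>. Taking the smaller of the residues of \<open>j\<close> and \<open>- j\<close>
  makes symmetry and periodicity immediate.\<close>

definition cyc :: "int \<Rightarrow> int \<Rightarrow> int" where
  "cyc n j = min (j mod n) ((- j) mod n)"

definition cdist :: "int \<Rightarrow> int \<Rightarrow> int \<Rightarrow> int \<Rightarrow> int \<Rightarrow> int" where
  "cdist n i j i' j' = \<bar>i - i'\<bar> + cyc n (j - j')"

lemma cyc_uminus: "cyc n (- j) = cyc n j"
  by (simp add: cyc_def min.commute)

lemma cyc_mod: "cyc n (j mod n) = cyc n j"
  by (simp add: cyc_def mod_minus_eq)

lemma cyc_cong:
  assumes "j mod n = j' mod n"
  shows "cyc n j = cyc n j'"
  by (metis assms cyc_mod)

lemma cyc_eq:
  assumes "\<bar>j\<bar> \<le> n"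
  shows "cyc n j = min \<bar>j\<bar> (n - \<bar>j\<bar>)"
proof (cases "\<bar>j\<bar> = n \<or> j = 0")
  case True
  then show ?thesis using assms by (auto simp: cyc_def abs_if split: if_splits)
next
  case False
  have *: "cyc n \<bar>j\<bar> = min \<bar>j\<bar> (n - \<bar>j\<bar>)"
  proof -
    have "\<bar>j\<bar> mod n = \<bar>j\<bar>" using assms False by simp
    moreover have "(- \<bar>j\<bar>) mod n = n - \<bar>j\<bar>"
      using assms False by (simp add: zmod_zminus1_eq_if)
    ultimately show ?thesis by (simp add: cyc_def)
  qed
  show ?thesis using * cyc_uminus[of n j] by (cases "j \<ge> 0") auto
qed

lemma cyc_nonneg: "n > 0 \<Longrightarrow> 0 \<le> cyc n j"
  by (simp add: cyc_def)

text \<open>For the representative nearest to 0, \<open>cyc n j\<close> is just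
  \<open>\<bar>j'\<bar>\<close>, so later case distinctions become linear arithmetic.\<close>

lemma cyc_rep:
  fixes n :: int
  assumes "n > 0"
  obtains j' where "j' mod n = j mod n" "- n < 2 * j'" "2 * j' \<le> n"
proof (cases "2 * (j mod n) \<le> n")
  case True
  moreover have "0 \<le> j mod n" using assms by simp
  ultimately show ?thesis using that[of "j mod n"] assms by (simp del: pos_mod_sign)
next
  case False
  moreover have "j mod n < n" using assms by simp
  ultimately show ?thesis using that[of "j mod n - n"] by (simp add: mod_diff_right_eq)
qed

lemma cdist_sym: "cdist n i j i' j' = cdist n i' j' i j"
  using cyc_uminus[of n "j - j'"] by (simp add: cdist_def abs_minus_commute)

lemma cdist_cong:
  assumes "j1 mod n = j2 mod n" "j1' mod n = j2' mod n"
  shows "cdist n i j1 i' j1' = cdist n i j2 i' j2'"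
  using cyc_cong[of "j1 - j1'" n "j2 - j2'"] mod_diff_cong[OF assms]
  by (simp add: cdist_def)

lemma cdist_transform:
  assumes "s = 1 \<or> s = -1" "t = 1 \<or> t = -1"
  shows "cdist n (x + s * i) (y + t * j) (x + s * i') (y + t * j') = cdist n i j i' j'"
  using assms cyc_uminus[of n "j - j'"] by (auto simp: cdist_def abs_minus_commute)

lemma cdist_nonneg: "n > 0 \<Longrightarrow> 0 \<le> cdist n i j i' j'"
  using cyc_nonneg[of n "j - j'"] by (simp add: cdist_def)

lemma cdist_eq_0D:
  assumes "n > 0" "cdist n i j i' j' = 0"
  shows "i = i'" "j mod n = j' mod n"
proof -
  have *: "\<bar>i - i'\<bar> = 0" "cyc n (j - j') = 0"
    using assms cyc_nonneg[of n "j - j'"] by (auto simp: cdist_def)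
  then show "i = i'" by simp
  have "n dvd j - j' \<or> n dvd - (j - j')"
    using *(2) by (auto simp: cyc_def min_def dvd_eq_mod_eq_0 split: if_splits)
  then have "n dvd j - j'" using dvd_minus_iff[of n "j - j'"] by blast
  then show "j mod n = j' mod n" by (simp add: mod_eq_dvd_iff)
qed

text \<open>
  Cylinder colorings are unrolled to the strip \<open>[A, B] \<times> \<int>\<close> with period \<open>n\<close>, so that any vertex can be
  moved to the origin and the two directions can be reflected.
\<close>

locale strip_coloring =
  fixes A B n :: int and c :: "int \<Rightarrow> int \<Rightarrow> nat" and R G W :: nat
  assumes AB: "A < B" and n3: "3 \<le> n"
    and per: "c i (j mod n) = c i j"
    and cols: "A \<le> i \<Longrightarrow> i \<le> B \<Longrightarrow> c i j = R \<or> c i j = G \<or> c i j = W"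
    and dst: "R \<noteq> G" "R \<noteq> W" "G \<noteq> W"
    and no_rainbow: "cdist n i2 j2 i1 j1 = cdist n i2 j2 i3 j3 \<Longrightarrow> A \<le> i1 \<Longrightarrow> i1 \<le> B \<Longrightarrow>
       A \<le> i2 \<Longrightarrow> i2 \<le> B \<Longrightarrow> A \<le> i3 \<Longrightarrow> i3 \<le> B \<Longrightarrow>
       c i1 j1 = c i2 j2 \<or> c i2 j2 = c i3 j3 \<or> c i1 j1 = c i3 j3"
begin

lemma c_cong: "j mod n = j' mod n \<Longrightarrow> c i j = c i j'"
  by (metis per)

lemma same_point: "cdist n i j i' j' = 0 \<Longrightarrow> c i j = c i' j'"
  using cdist_eq_0D[of n i j i' j'] n3 c_cong[of j j' i] by auto

text \<open>A third color on the sphere through \<open>(i1, j1)\<close> would give a rainbow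
  progression centered at \<open>(i, j)\<close>.\<close>

lemma sphere_color:
  assumes "c i j = P" "c i1 j1 = Q" "P \<noteq> Q" "cdist n i j i1 j1 = cdist n i j i2 j2"
    "A \<le> i" "i \<le> B" "A \<le> i1" "i1 \<le> B" "A \<le> i2" "i2 \<le> B"
  shows "c i2 j2 = P \<or> c i2 j2 = Q"
  using no_rainbow[of i j i1 j1 i2 j2] assms by auto

text \<open>The sphere around the \<open>R\<close> vertex allows \<open>R\<close> and
  \<open>W\<close>, the one around the \<open>G\<close> vertex allows \<open>G\<close> and
  \<open>W\<close>.\<close>

lemma common_sphere_color:
  assumes "c i j = R" "c i' j' = G" "c p q = W"
    "cdist n i j p q = cdist n i j p' q'" "cdist n i' j' p q = cdist n i' j' p' q'"
    "A \<le> i" "i \<le> B" "A \<le> i'" "i' \<le> B" "A \<le> p" "p \<le> B" "A \<le> p'" "p' \<le> B"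
  shows "c p' q' = W"
  using sphere_color[of i j R p q W p' q'] sphere_color[of i' j' G p q W p' q'] assms dst by auto

text \<open>Translations and reflections are isometries. The interval \<open>[A', B']\<close> is the
  preimage of \<open>[A, B]\<close>; the equivalence covers both signs of \<open>s\<close>.\<close>

lemma transform:
  assumes "s = 1 \<or> s = -1" "t = 1 \<or> t = -1"
    and "\<And>i. A' \<le> i \<and> i \<le> B' \<longleftrightarrow> A \<le> x + s * i \<and> x + s * i \<le> B"
  shows "strip_coloring A' B' n (\<lambda>i j. c (x + s * i) (y + t * j)) R G W"
proof unfold_locales
  show "A' < B'"
    using assms(1) assms(3)[of "s * (A - x)"] assms(3)[of "s * (B - x)"] AB
    by auto
  show "3 \<le> n" by (fact n3)
  show "c (x + s * i) (y + t * (j mod n)) = c (x + s * i) (y + t * j)" for i j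
    using assms(2) by (intro c_cong) (auto simp: mod_add_right_eq mod_diff_right_eq)
  show "c (x + s * i) (y + t * j) = R \<or> c (x + s * i) (y + t * j) = G \<or> c (x + s * i) (y + t * j) = W"
    if "A' \<le> i" "i \<le> B'" for i j using cols assms(3) that by blast
  show "R \<noteq> G" "R \<noteq> W" "G \<noteq> W" by (fact dst)+
  fix i1 j1 i2 j2 i3 j3
  assume "cdist n i2 j2 i1 j1 = cdist n i2 j2 i3 j3"
    and r: "A' \<le> i1" "i1 \<le> B'" "A' \<le> i2" "i2 \<le> B'" "A' \<le> i3" "i3 \<le> B'"
  then have "cdist n (x + s * i2) (y + t * j2) (x + s * i1) (y + t * j1)
      = cdist n (x + s * i2) (y + t * j2) (x + s * i3) (y + t * j3)"
    by (simp only: cdist_transform[OF assms(1,2)])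
  then show "c (x + s * i1) (y + t * j1) = c (x + s * i2) (y + t * j2) \<or>
       c (x + s * i2) (y + t * j2) = c (x + s * i3) (y + t * j3) \<or>
       c (x + s * i1) (y + t * j1) = c (x + s * i3) (y + t * j3)"
    using r assms(3) by (intro no_rainbow) blast+
qed

end

section \<open>Colorings in which all three pairs of colors are adjacent\<close>

locale touching_coloring = strip_coloring +
  fixes k :: int
  assumes k2: "2 \<le> k"
    and kmin: "cdist n i j i' j' = 1 \<Longrightarrow> c i j = R \<Longrightarrow> c i' j' = G \<Longrightarrow> c p q = W \<Longrightarrow>
      A \<le> i \<Longrightarrow> i \<le> B \<Longrightarrow> A \<le> i' \<Longrightarrow> i' \<le> B \<Longrightarrow> A \<le> p \<Longrightarrow> p \<le> B \<Longrightarrow>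
      k \<le> cdist n i j p q \<and> k \<le> cdist n i' j' p q"
    and edgeR: "\<exists>i j p q. cdist n p q i j = 1 \<and> c i j = R \<and> c p q = W \<and>
      A \<le> i \<and> i \<le> B \<and> A \<le> p \<and> p \<le> B"
    and edgeG: "\<exists>i j p q. cdist n p q i j = 1 \<and> c i j = G \<and> c p q = W \<and>
      A \<le> i \<and> i \<le> B \<and> A \<le> p \<and> p \<le> B"
begin

lemma transform:
  assumes s: "s = 1 \<or> s = -1" "t = 1 \<or> t = -1"
    and r: "\<And>i. A' \<le> i \<and> i \<le> B' \<longleftrightarrow> A \<le> x + s * i \<and> x + s * i \<le> B"
  shows "touching_coloring A' B' n (\<lambda>i j. c (x + s * i) (y + t * j)) R G W k"
proof -
  interpret S: strip_coloring A' B' n "\<lambda>i j. c (x + s * i) (y + t * j)" R G W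
    using transform assms by blast
  have inv: "x + s * (s * (i - x)) = i" "y + t * (t * (j - y)) = j" for i j
    using s by auto
  have edge: "\<exists>i j p q. cdist n p q i j = 1 \<and> c (x + s * i) (y + t * j) = Q \<and>
      c (x + s * p) (y + t * q) = W \<and> A' \<le> i \<and> i \<le> B' \<and> A' \<le> p \<and> p \<le> B'"
    if h: "cdist n p q i j = 1" "c i j = Q" "c p q = W"
      "A \<le> i" "i \<le> B" "A \<le> p" "p \<le> B" for i j p q Q
  proof -
    have "cdist n (s * (p - x)) (t * (q - y)) (s * (i - x)) (t * (j - y)) = 1"
      using cdist_transform[OF s, of n x "s * (p - x)" y "t * (q - y)" "s * (i - x)" "t * (j - y)"] h
      by (simp add: inv)
    then show ?thesis using h r[of "s * (p - x)"] r[of "s * (i - x)"] inv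
      by (intro exI[of _ "s * (i - x)"] exI[of _ "t * (j - y)"] exI[of _ "s * (p - x)"]
          exI[of _ "t * (q - y)"]) auto
  qed
  show ?thesis
  proof unfold_locales
    show "2 \<le> k" by (fact k2)
    show "\<exists>i j p q. cdist n p q i j = 1 \<and> c (x + s * i) (y + t * j) = R \<and>
      c (x + s * p) (y + t * q) = W \<and> A' \<le> i \<and> i \<le> B' \<and> A' \<le> p \<and> p \<le> B'"
      using edgeR edge by blast
    show "\<exists>i j p q. cdist n p q i j = 1 \<and> c (x + s * i) (y + t * j) = G \<and>
      c (x + s * p) (y + t * q) = W \<and> A' \<le> i \<and> i \<le> B' \<and> A' \<le> p \<and> p \<le> B'"
      using edgeG edge by blast
    show "k \<le> cdist n i j p q \<and> k \<le> cdist n i' j' p q"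
      if "cdist n i j i' j' = 1" "c (x + s * i) (y + t * j) = R" "c (x + s * i') (y + t * j') = G"
      "c (x + s * p) (y + t * q) = W" "A' \<le> i" "i \<le> B'" "A' \<le> i'" "i' \<le> B'" "A' \<le> p" "p \<le> B'"
      for i j i' j' p q
      using kmin[of "x + s * i" "y + t * j" "x + s * i'" "y + t * j'" "x + s * p" "y + t * q"]
        that r[of i] r[of i'] r[of p] by (simp add: cdist_transform[OF s])
  qed
qed

text \<open>By this symmetry the distance \<open>k\<close> may be assumed to occur at the
  \<open>G\<close> end of an edge.\<close>

lemma swap: "touching_coloring A B n c G R W k"
proof unfold_locales
  show "k \<le> cdist n i j p q \<and> k \<le> cdist n i' j' p q"
    if "cdist n i j i' j' = 1" "c i j = G" "c i' j' = R" "c p q = W" "A \<le> i" "i \<le> B" "A \<le> i'"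
      "i' \<le> B" "A \<le> p" "p \<le> B" for i j i' j' p q
    using kmin[of i' j' i j p q] cdist_sym[of n i j i' j'] that by simp
  show "c i1 j1 = c i2 j2 \<or> c i2 j2 = c i3 j3 \<or> c i1 j1 = c i3 j3"
    if "cdist n i2 j2 i1 j1 = cdist n i2 j2 i3 j3" "A \<le> i1" "i1 \<le> B" "A \<le> i2" "i2 \<le> B" "A \<le> i3" "i3 \<le> B"
    for i1 j1 i2 j2 i3 j3 using no_rainbow that by blast
  show "c i j = G \<or> c i j = R \<or> c i j = W" if "A \<le> i" "i \<le> B" for i j
    using cols that by blast
qed (use AB n3 per dst k2 edgeR edgeG in auto)

text \<open>
  The vertex \<open>(1, -1)\<close> is excluded from each color: it lies on a geodesic from \<open>(1, 0)\<close> to a second \<open>W\<close>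
  vertex \<open>(p, q)\<close>, and on the same sphere around \<open>(1 + a, b)\<close> as the origin.
\<close>

lemma horizontal_low:
  assumes "c 0 0 = R" "c 1 0 = G" "c (1 + a) b = W" "0 \<le> a" "0 \<le> b" "a + b = k"
    "A \<le> 0" "1 + a \<le> B" "2 * b + 2 \<le> n"
  shows False
proof -
  \<comment> \<open>The reflection \<open>(1 + a, - b)\<close> is the natural second
    \<open>W\<close> vertex. For \<open>b = 0\<close> it coincides with the first one, so there a
    step along the path is traded for one around the cycle.\<close>
  define w2 where "w2 = (if b = 0 then (k, -1) else (1 + a, - b))"
  obtain p q where pq: "w2 = (p, q)" by (cases w2)
  have p: "1 \<le> p" "p \<le> 1 + a" "q < 0" "p - 1 - q = k" "- q \<le> b \<or> q = -1"
    using pq assms k2 by (auto simp: w2_def split: if_splits)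
  have q: "- 2 * q \<le> n" using p assms n3 by linarith
  note dd = cdist_def cyc_eq min_def abs_if
  have 1: "cdist n 0 0 (1 + a) b = k + 1" "cdist n 0 0 p q = k + 1" "cdist n 1 0 (1 + a) b = k"
     "cdist n 1 0 p q = k"
    using assms p q by (auto simp: dd)
  have w2: "c p q = W"
    using common_sphere_color[of 0 0 1 0 "1 + a" b p q] 1 assms p by simp
  have 2: "cdist n (1 + a) b 1 (-1) = k + 1" "cdist n (1 + a) b 0 0 = k + 1"
    "cdist n p q 1 (-1) = k - 1" "cdist n 1 (-1) p q = k - 1"
    "cdist n 1 0 1 (-1) = 1" "cdist n 1 (-1) 1 0 = 1" "cdist n 0 0 1 0 = 1"
    using assms p q n3 by (auto simp: dd)
  have "c 1 (-1) = W \<or> c 1 (-1) = R"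
    using sphere_color[of "1 + a" b W 0 0 R 1 "-1"] 2 assms dst by simp
  moreover have "c 1 (-1) = G \<or> c 1 (-1) = R"
    using sphere_color[of 1 0 G 0 0 R 1 "-1"] 2 assms dst cdist_sym[of n 1 0 0 0] by simp
  moreover have "c 1 (-1) \<noteq> R"
    using kmin[of 1 "-1" 1 0 p q] 2 assms p w2 by auto
  ultimately show False using dst by simp
qed

text \<open>The reflection \<open>(1 + a, - b)\<close> is \<open>W\<close> too. Around the two
  \<open>W\<close> vertices, \<open>(0, 1)\<close> shares a sphere with \<open>(1, 0)\<close> and
  with the origin respectively, which leaves only \<open>W\<close>; but it is adjacent to the
  origin, whose unit sphere already contains \<open>G\<close>.\<close>

lemma horizontal_odd:
  assumes "c 0 0 = R" "c 1 0 = G" "c (1 + a) b = W" "0 \<le> a" "0 \<le> b" "a + b = k"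
    "A \<le> 0" "1 + a \<le> B" "2 * b + 1 = n"
  shows False
proof -
  note dd = cdist_def cyc_eq min_def abs_if
  have 1: "cdist n 0 0 (1 + a) b = k + 1" "cdist n 0 0 (1 + a) (- b) = k + 1"
    "cdist n 1 0 (1 + a) b = k" "cdist n 1 0 (1 + a) (- b) = k"
    "cdist n (1 + a) b 0 1 = k" "cdist n (1 + a) b 1 0 = k"
    "cdist n (1 + a) (- b) 0 1 = k + 1" "cdist n (1 + a) (- b) 0 0 = k + 1"
    "cdist n 0 0 0 1 = 1" "cdist n 0 0 1 0 = 1"
    using assms n3 by (auto simp: dd)
  have w2: "c (1 + a) (- b) = W"
    using common_sphere_color[of 0 0 1 0 "1 + a" b "1 + a" "- b"] 1 assms by simp
  have "c 0 1 = W \<or> c 0 1 = G"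
    using sphere_color[of "1 + a" b W 1 0 G 0 1] 1 assms dst by simp
  moreover have "c 0 1 = W \<or> c 0 1 = R"
    using sphere_color[of "1 + a" "- b" W 0 0 R 0 1] 1 assms dst w2 by simp
  moreover have "c 0 1 = R \<or> c 0 1 = G"
    using sphere_color[of 0 0 R 1 0 G 0 1] 1 assms dst by simp
  ultimately show False using dst by auto
qed

text \<open>Here \<open>b\<close> is half the cycle, so reflection gives no second \<open>W\<close>
  vertex. Room beyond either end of the strip leads back to \<open>horizontal_low\<close>. Without
  it, the \<open>W\<close> vertex is the antipode of the origin and the only one of its color, so
  its unit sphere contains both \<open>R\<close> and \<open>G\<close>.\<close>

lemma horizontal_even:
  assumes "c 0 0 = R" "c 1 0 = G" "c (1 + a) b = W" "0 \<le> a" "0 \<le> b" "a + b = k"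
    "A \<le> 0" "1 + a \<le> B" "2 * b = n"
  shows False
proof -
  note dd = cdist_def cyc_eq min_def abs_if
  have 1: "cdist n 0 0 (1 + a) b = k + 1" "cdist n 0 0 (2 + a) (b - 1) = k + 1"
    "cdist n 1 0 (1 + a) b = k" "cdist n 1 0 (2 + a) (b - 1) = k"
    "cdist n (1 + a) b 0 1 = k" "cdist n (1 + a) b 1 0 = k"
    "cdist n (1 + a) b (-1) 1 = k + 1" "cdist n (1 + a) b 0 0 = k + 1"
    "cdist n 0 0 0 1 = 1" "cdist n 0 0 1 0 = 1" "cdist n 0 1 (-1) 1 = 1" "cdist n 0 1 0 0 = 1"
    using assms n3 by (auto simp: dd)
  have B: "B = 1 + a"
  proof (rule ccontr)
    assume "B \<noteq> 1 + a"
    then have "2 + a \<le> B" using assms by simp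
    moreover have "c (2 + a) (b - 1) = W"
      using common_sphere_color[of 0 0 1 0 "1 + a" b "2 + a" "b - 1"] 1 assms \<open>2 + a \<le> B\<close> by simp
    ultimately show False using horizontal_low[of "1 + a" "b - 1"] assms n3 by simp
  qed
  \<comment> \<open>This gives a second edge between \<open>R\<close> and \<open>G\<close>, in the
    cycle direction, to which \<open>kmin\<close> applies as well.\<close>
  have G01: "c 0 1 = G"
    using sphere_color[of "1 + a" b W 1 0 G 0 1] sphere_color[of 0 0 R 1 0 G 0 1] 1 assms dst by auto
  have A: "A = 0"
  proof (rule ccontr)
    assume "A \<noteq> 0"
    then have A: "A \<le> -1" using assms by simp
    then have R1: "c (-1) 1 = R"
      using sphere_color[of "1 + a" b W 0 0 R "-1" 1] sphere_color[of 0 1 G 0 0 R "-1" 1] 1 assms dst G01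
      by auto
    interpret S: touching_coloring "A + 1" "B + 1" n "\<lambda>i j. c (-1 + 1 * i) (1 + 1 * j)" R G W k
      by (rule transform) auto
    \<comment> \<open>After the shift the edge from \<open>(-1, 1)\<close> to \<open>(0, 1)\<close>
      starts at the origin, and the \<open>W\<close> vertex has coordinates
      \<open>(2 + a, b - 1)\<close>, one row short of the opposite row.\<close>
    show False
      using S.horizontal_low[of "1 + a" "b - 1"] A assms n3 G01 R1 by simp
  qed
  \<comment> \<open>Every \<open>W\<close> vertex is the given one: the bounds from
    \<open>(0, 0)\<close>, \<open>(1, 0)\<close> and \<open>(0, 1)\<close> exclude all other
    positions. This is stated through distances because the second coordinate is determined only
    modulo \<open>n\<close>.\<close>
  have uniq: "cdist n (1 + a) b i j = cdist n p q i j"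
    if h: "c p q = W" "A \<le> p" "p \<le> B" for p q i j
  proof -
    obtain q' where q': "q' mod n = q mod n" "- n < 2 * q'" "2 * q' \<le> n"
      using cyc_rep[of n q] n3 by auto
    then have "c p q' = W" using h c_cong by metis
    then have "k \<le> cdist n 0 0 p q'" "k \<le> cdist n 1 0 p q'" "k \<le> cdist n 0 1 p q'"
      using kmin[of 0 0 1 0 p q'] kmin[of 0 0 0 1 p q'] 1 assms h G01 by auto
    moreover have "cdist n 0 0 p q' = p + \<bar>q'\<bar>" "cdist n 1 0 p q' = \<bar>p - 1\<bar> + \<bar>q'\<bar>"
      using q' h A by (auto simp: dd)
    moreover have "cdist n 0 1 p q' = p + (if q' \<le> 0 \<and> n \<noteq> - 2 * q' \<and> n \<noteq> 1 - 2 * q' then 1 - q' else if q' \<ge> 1 then q' - 1 else b - 1)"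
      if "-q' < b"
      using q' h A that assms n3 by (auto simp: dd)
    ultimately have "p = 1 + a \<and> q' = b"
      using q' h A B assms n3 by (auto split: if_splits)
    then show ?thesis using cdist_cong[OF q'(1) refl, of p i j] by simp
  qed
  obtain i j p q where R: "cdist n p q i j = 1" "c i j = R" "c p q = W" "A \<le> i" "i \<le> B" "A \<le> p" "p \<le> B"
    using edgeR by blast
  obtain i' j' p' q' where G: "cdist n p' q' i' j' = 1" "c i' j' = G" "c p' q' = W"
    "A \<le> i'" "i' \<le> B" "A \<le> p'" "p' \<le> B"
    using edgeG by blast
  show False
    using sphere_color[of "1 + a" b W i j R i' j'] uniq[of p q i j] uniq[of p' q' i' j'] R G dst assms by auto
qed

lemma horizontal_nonneg:
  assumes "c 0 0 = R" "c 1 0 = G" "c (1 + a) b = W" "0 \<le> a" "0 \<le> b" "a + b = k"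
    "A \<le> 0" "1 + a \<le> B" "2 * b \<le> n"
  shows False
  using horizontal_low[OF assms(1-8)] horizontal_odd[OF assms(1-8)] horizontal_even[OF assms(1-8)] assms(9)
  by linarith


text \<open>The \<open>W\<close> vertex is not equidistant from the two ends, as its sphere would
  contain \<open>R\<close> and \<open>G\<close>. Minimality makes the origin the farther end, hence
  \<open>1 \<le> p\<close>, and a reflection makes the second coordinate nonnegative.\<close>

lemma horizontal:
  assumes "c 0 0 = R" "c 1 0 = G" "c p q = W" "cdist n 1 0 p q = k"
    "A \<le> 0" "1 \<le> B" "A \<le> p" "p \<le> B"
  shows False
proof -
  obtain q' where q': "q' mod n = q mod n" "- n < 2 * q'" "2 * q' \<le> n"
    using cyc_rep[of n q] n3 by auto
  have w: "c p q' = W" "cdist n 1 0 p q' = k"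
    using assms c_cong[OF q'(1)] cdist_cong[OF refl q'(1)] by simp_all
  have e: "cdist n 0 0 p q' = \<bar>p\<bar> + \<bar>q'\<bar>" "cdist n 1 0 p q' = \<bar>p - 1\<bar> + \<bar>q'\<bar>"
    using q' by (auto simp: cdist_def cyc_eq min_def abs_if)
  have "k \<le> cdist n 0 0 p q'"
    using kmin[of 0 0 1 0 p q'] w assms n3 by (simp add: cdist_def cyc_eq)
  moreover have "cdist n 0 0 p q' \<noteq> k"
    using sphere_color[of p q' W 0 0 R 1 0] w assms dst cdist_sym[of n p q'] by auto
  ultimately have p: "1 \<le> p" using e w(2) by linarith
  show False
  proof (cases "0 \<le> q'")
    case True
    then show False using horizontal_nonneg[of "p - 1" q'] assms w e p q' by simp
  next
    case False
    interpret S: touching_coloring A B n "\<lambda>i j. c (0 + 1 * i) (0 + (-1) * j)" R G W k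
      by (rule transform) auto
    show False using False S.horizontal_nonneg[of "p - 1" "- q'"] assms w e p q' by simp
  qed
qed

text \<open>If \<open>W\<close> lies off the copy of the cycle containing the edge,
  \<open>(1, 0)\<close> is forced to be \<open>G\<close>, giving a horizontal edge with the same
  \<open>k\<close>. Otherwise a neighboring copy contains an \<open>R\<close> vertex adjacent to
  \<open>(0, 1)\<close> and a \<open>W\<close> vertex only \<open>k - 1\<close> away from
  it.\<close>

lemma vertical_nonneg:
  assumes "c 0 0 = R" "c 0 1 = G" "c p q = W" "0 \<le> p" "1 \<le> q" "2 * q \<le> n" "p + q = k + 1"
    "A \<le> 0" "p \<le> B"
  shows False
proof (cases "p = 0")
  case True
  \<comment> \<open>Since \<open>A < B\<close>, a neighboring copy of the cycle exists on at least
    one side.\<close>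
  obtain s :: int where s: "s = 1 \<or> s = - 1" "A \<le> s" "s \<le> B"
    using AB assms by (cases "A \<le> - 1") (auto intro: that[of 1] that[of "-1"])
  have 1: "cdist n 0 0 0 q = k + 1" "cdist n 0 0 s k = k + 1" "cdist n 0 1 0 q = k"
    "cdist n 0 1 s k = k" "cdist n 0 q s 1 = k + 1" "cdist n 0 q 0 0 = k + 1"
    "cdist n 0 1 s 1 = 1" "cdist n 0 1 0 0 = 1" "cdist n s 1 s k = k - 1" "cdist n s 1 0 1 = 1"
    using s True assms k2 n3 by (auto simp: cdist_def cyc_eq min_def abs_if)
  have "c s k = W"
    using common_sphere_color[of 0 0 0 1 0 q s k] 1 True s assms by simp
  moreover have "c s 1 = R"
    using sphere_color[of 0 q W 0 0 R s 1] sphere_color[of 0 1 G 0 0 R s 1] 1 True s assms dst by auto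
  ultimately show False
    using kmin[of s 1 0 1 s k] 1 True s assms by simp
next
  case False
  have 1: "cdist n p q 1 0 = k" "cdist n p q 0 1 = k" "cdist n 0 0 0 1 = 1" "cdist n 0 0 1 0 = 1"
    using False assms k2 n3 by (auto simp: cdist_def cyc_eq min_def abs_if)
  have "c 1 0 = G"
    using sphere_color[of p q W 0 1 G 1 0] sphere_color[of 0 0 R 0 1 G 1 0] 1 False assms dst by auto
  then show False
    using horizontal[of p q] 1 False assms cdist_sym[of n p q] by simp
qed

lemma vertical:
  assumes "c 0 0 = R" "c 0 1 = G" "c p q = W" "cdist n 0 1 p q = k"
    "A \<le> 0" "0 \<le> B" "A \<le> p" "p \<le> B"
  shows False
proof -
  obtain q' where q': "q' mod n = q mod n" "- n < 2 * q'" "2 * q' \<le> n"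
    using cyc_rep[of n q] n3 by auto
  have w: "c p q' = W" "cdist n 0 1 p q' = k"
    using assms c_cong[OF q'(1)] cdist_cong[OF refl q'(1)] by simp_all
  have "k \<le> cdist n 0 0 p q'"
    using kmin[of 0 0 0 1 p q'] w assms n3 by (simp add: cdist_def cyc_eq)
  moreover have "cdist n 0 0 p q' \<noteq> k"
    using sphere_color[of p q' W 0 0 R 0 1] w assms dst cdist_sym[of n p q'] by auto
  moreover have "cdist n 0 0 p q' = \<bar>p\<bar> + \<bar>q'\<bar>"
    using q' by (auto simp: cdist_def cyc_eq min_def abs_if)
  moreover have "q' \<le> 0 \<Longrightarrow> cdist n 0 1 p q' \<ge> \<bar>p\<bar> + \<bar>q'\<bar>"
    "q' \<ge> 1 \<Longrightarrow> cdist n 0 1 p q' = \<bar>p\<bar> + q' - 1"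
    using q' n3 by (auto simp: cdist_def cyc_eq min_def abs_if)
  ultimately have q: "1 \<le> q'" "\<bar>p\<bar> + q' = k + 1" using w(2) by linarith+
  show False
  proof (cases "0 \<le> p")
    case True
    then show False using vertical_nonneg[of p q'] assms w q q' by simp
  next
    case False
    interpret S: touching_coloring "- B" "- A" n "\<lambda>i j. c (0 + (-1) * i) (0 + 1 * j)" R G W k
      by (rule transform) auto
    show False using False S.vertical_nonneg[of "- p" q'] assms w q q' by simp
  qed
qed

text \<open>As \<open>kmin\<close> only bounds distances from below, attainment is a separate
  hypothesis. A translation moves the \<open>R\<close> end of the edge to the origin, and a
  reflection points the edge in a positive direction.\<close>

lemma not_attained:
  assumes "c x y = R" "c x' y' = G" "c p q = W" "cdist n x y x' y' = 1" "cdist n x' y' p q = k"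
    "A \<le> x" "x \<le> B" "A \<le> x'" "x' \<le> B" "A \<le> p" "p \<le> B"
  shows False
proof -
  obtain d where d: "d mod n = (y' - y) mod n" "- n < 2 * d" "2 * d \<le> n"
    using cyc_rep[of n "y' - y"] n3 by auto
  have yd: "(y + d) mod n = y' mod n"
    using mod_add_cong[OF refl d(1), of y] by simp
  then have "cdist n x y x' (y + d) = 1" and k: "cdist n x' (y + d) p q = k"
    and G: "c x' (y + d) = G"
    using assms cdist_cong[OF refl yd] cdist_cong[OF yd refl] c_cong[OF yd] by simp_all
  then have xd: "\<bar>x - x'\<bar> + \<bar>d\<bar> = 1"
    using d(2,3) by (simp add: cdist_def cyc_eq)
  define s where "s = (if x = x' then 1 else x' - x)"
  define t where "t = (if x = x' then d else 1)"
  have st: "s = 1 \<or> s = -1" "t = 1 \<or> t = -1"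
    using xd by (auto simp: s_def t_def)
  define A' B' where "A' = (if s = 1 then A - x else x - B)" "B' = (if s = 1 then B - x else x - A)"
  interpret S: touching_coloring A' B' n "\<lambda>i j. c (x + s * i) (y + t * j)" R G W k
    using st by (intro transform) (auto simp: A'_B'_def)
  have inv: "x + s * (s * (p - x)) = p" "y + t * (t * (q - y)) = q"
    using st by auto
  have r: "A' \<le> 0" "0 \<le> B'" "A' \<le> s * (p - x)" "s * (p - x) \<le> B'"
    using assms st by (auto simp: A'_B'_def)
  show False
  proof (cases "x = x'")
    case True
    have "cdist n (x + s * 0) (y + t * 1) (x + s * (s * (p - x))) (y + t * (t * (q - y))) = k"
      unfolding inv using k True by (simp add: t_def)
    then have "cdist n 0 1 (s * (p - x)) (t * (q - y)) = k"
      by (simp only: cdist_transform[OF st])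
    then show False
      using S.vertical[of "s * (p - x)" "t * (q - y)"] True assms G inv r by (simp add: t_def s_def)
  next
    case False
    then have d0: "d = 0" using xd by linarith
    have xs: "x + s = x'" using False by (simp add: s_def)
    then have "cdist n 1 0 (s * (p - x)) (t * (q - y)) = k"
      using cdist_transform[OF st, of n x 1 y 0 "s * (p - x)" "t * (q - y)"] k d0
      by (simp add: inv)
    moreover have "1 \<le> B'"
      using st assms False xs by (auto simp: A'_B'_def)
    ultimately show False
      using S.horizontal[of "s * (p - x)" "t * (q - y)"] assms G inv r d0 xs by simp
  qed
qed

end

context strip_coloring
begin

text \<open>The predicate \<open>Q\<close> collects the distances from \<open>W\<close> vertices to
  ends of edges between \<open>R\<close> and \<open>G\<close>. Whichever end attains the least one,
  \<open>not_attained\<close> applies, after \<open>swap\<close> if it is the \<open>R\<close>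
  end.\<close>

lemma not_all_adjacent:
  assumes RG: "cdist n x y x' y' = 1" "c x y = R" "c x' y' = G" "A \<le> x" "x \<le> B" "A \<le> x'" "x' \<le> B"
    and edgeR: "\<exists>i j p q. cdist n p q i j = 1 \<and> c i j = R \<and> c p q = W \<and>
      A \<le> i \<and> i \<le> B \<and> A \<le> p \<and> p \<le> B"
    and edgeG: "\<exists>i j p q. cdist n p q i j = 1 \<and> c i j = G \<and> c p q = W \<and>
      A \<le> i \<and> i \<le> B \<and> A \<le> p \<and> p \<le> B"
  shows False
proof -
  define Q where "Q d \<longleftrightarrow> (\<exists>i j i' j' p q. cdist n i j i' j' = 1 \<and> c i j = R \<and> c i' j' = G \<and> c p q = W \<and>
    A \<le> i \<and> i \<le> B \<and> A \<le> i' \<and> i' \<le> B \<and> A \<le> p \<and> p \<le> B \<and>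
    (int d = cdist n i j p q \<or> int d = cdist n i' j' p q))" for d :: nat
  have n0: "n > 0" using n3 by simp
  have nn: "cdist n i j p q = int (nat (cdist n i j p q))" for i j p q
    using cdist_nonneg[OF n0, of i j p q] by simp
  have QI: "Q (nat (cdist n i j p q))" "Q (nat (cdist n i' j' p q))"
    if "cdist n i j i' j' = 1" "c i j = R" "c i' j' = G" "c p q = W"
    "A \<le> i" "i \<le> B" "A \<le> i'" "i' \<le> B" "A \<le> p" "p \<le> B" for i j i' j' p q
    unfolding Q_def using that nn[of i j p q] nn[of i' j' p q] by metis+
  obtain p q where "c p q = W" "A \<le> p" "p \<le> B" using edgeR by blast
  then have "Q (nat (cdist n x y p q))" using QI RG by blast
  define d where "d = (LEAST d. Q d)"
  have "Q d" unfolding d_def by (rule LeastI) fact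
  then obtain i j i' j' p q where h: "cdist n i j i' j' = 1" "c i j = R" "c i' j' = G" "c p q = W"
    "A \<le> i" "i \<le> B" "A \<le> i'" "i' \<le> B" "A \<le> p" "p \<le> B"
    and dd: "int d = cdist n i j p q \<or> int d = cdist n i' j' p q"
    unfolding Q_def by blast
  have least: "int d \<le> cdist n i j p q \<and> int d \<le> cdist n i' j' p q"
    if "cdist n i j i' j' = 1" "c i j = R" "c i' j' = G" "c p q = W"
    "A \<le> i" "i \<le> B" "A \<le> i'" "i' \<le> B" "A \<le> p" "p \<le> B" for i j i' j' p q
  proof -
    have "d \<le> nat (cdist n i j p q)" unfolding d_def by (rule Least_le) (rule QI(1)[OF that])
    moreover have "d \<le> nat (cdist n i' j' p q)" unfolding d_def by (rule Least_le) (rule QI(2)[OF that])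
    ultimately show ?thesis
      using cdist_nonneg[OF n0, of i j p q] cdist_nonneg[OF n0, of i' j' p q] by linarith
  qed
  have "cdist n i j p q \<noteq> 0" "cdist n i' j' p q \<noteq> 0"
    using same_point h dst by metis+
  \<comment> \<open>At distance 1, the unit sphere around that end would contain both
    \<open>W\<close> and the color of the other end.\<close>
  moreover have "cdist n i j p q \<noteq> 1" "cdist n i' j' p q \<noteq> 1"
    using sphere_color[of i j R i' j' G p q] sphere_color[of i' j' G i j R p q] h dst cdist_sym[of n i j i' j'] by auto
  ultimately have "2 \<le> int d" using dd by auto
  then interpret T: touching_coloring A B n c R G W "int d"
    using least edgeR edgeG by unfold_locales blast+
  interpret T': touching_coloring A B n c G R W "int d"
    by (rule T.swap)
  show False
    using dd T.not_attained[of i j i' j' p q] T'.not_attained[of i' j' i j p q] h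
      cdist_sym[of n i j i' j'] by auto
qed

end

section \<open>Colorings with two non-adjacent colors\<close>

locale separated_coloring = strip_coloring +
  fixes k :: int
  assumes k2: "2 \<le> k"
    and kmin: "c i j = R \<Longrightarrow> c i' j' = G \<Longrightarrow>
      A \<le> i \<Longrightarrow> i \<le> B \<Longrightarrow> A \<le> i' \<Longrightarrow> i' \<le> B \<Longrightarrow> k \<le> cdist n i j i' j'"
begin

lemma transform:
  assumes s: "s = 1 \<or> s = -1" "t = 1 \<or> t = -1"
    and r: "\<And>i. A' \<le> i \<and> i \<le> B' \<longleftrightarrow> A \<le> x + s * i \<and> x + s * i \<le> B"
  shows "separated_coloring A' B' n (\<lambda>i j. c (x + s * i) (y + t * j)) R G W k"
proof -
  interpret S: strip_coloring A' B' n "\<lambda>i j. c (x + s * i) (y + t * j)" R G W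
    using transform assms by blast
  show ?thesis
  proof unfold_locales
    show "2 \<le> k" by (fact k2)
    show "k \<le> cdist n i j i' j'"
      if "c (x + s * i) (y + t * j) = R" "c (x + s * i') (y + t * j') = G"
      "A' \<le> i" "i \<le> B'" "A' \<le> i'" "i' \<le> B'" for i j i' j'
      using kmin[of "x + s * i" "y + t * j" "x + s * i'" "y + t * j'"]
        that r[of i] r[of i'] by (simp add: cdist_transform[OF s])
  qed
qed

text \<open>The sphere around \<open>(i, j)\<close> leaves \<open>R\<close> and \<open>G\<close>,
  and an \<open>R\<close> vertex would be too close to \<open>(i', j')\<close>.\<close>

lemma spread_G:
  assumes "c i j = R" "c i' j' = G" "cdist n i j i' j' = k" "cdist n i j p q = k" "cdist n i' j' p q < k"
    "A \<le> i" "i \<le> B" "A \<le> i'" "i' \<le> B" "A \<le> p" "p \<le> B"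
  shows "c p q = G"
  using sphere_color[of i j R i' j' G p q] kmin[of p q i' j'] assms dst cdist_sym[of n p q] by auto

lemma spread_R:
  assumes "c i j = R" "c i' j' = G" "cdist n i' j' i j = k" "cdist n i' j' p q = k" "cdist n i j p q < k"
    "A \<le> i" "i \<le> B" "A \<le> i'" "i' \<le> B" "A \<le> p" "p \<le> B"
  shows "c p q = R"
  using sphere_color[of i' j' G i j R p q] kmin[of i j p q] assms dst by auto

lemma odd_normalized:
  assumes "c 0 0 = R" "c a b = G" "0 \<le> a" "0 \<le> b" "2 * b \<le> n" "a + b = k" "A \<le> 0" "a \<le> B"
  shows "odd k"
proof
  assume "even k"
  then obtain l where l: "k = 2 * l" by blast
  \<comment> \<open>The geodesic runs along the path first and then around the cycle, with midpoint
    \<open>(i, l - i)\<close>. Minimality excludes \<open>R\<close> and \<open>G\<close> there,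
    while the sphere of radius \<open>l\<close> around it contains both.\<close>
  define i where "i = min a l"
  have i: "0 \<le> i" "i \<le> a" "i \<le> l" "l - i \<le> b" using assms l k2 by (auto simp: i_def)
  have 1: "cdist n 0 0 i (l - i) = l" "cdist n i (l - i) 0 0 = l" "cdist n i (l - i) a b = l"
    using i assms l by (auto simp: cdist_def cyc_eq min_def abs_if)
  show False
    using sphere_color[of i "l - i" "c i (l - i)" 0 0 R a b] kmin[of 0 0 i "l - i"] kmin[of i "l - i" a b]
      1 i assms l k2 dst cols[of i "l - i"] by auto
qed

text \<open>The induction trades path steps for cycle steps while the row permits. The cases
  \<open>a = 0\<close> and \<open>2 * b + 1 = n\<close> yield an \<open>R\<close> and a
  \<open>G\<close> vertex closer than \<open>k\<close>; so does \<open>2 * b = n\<close>, unless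
  \<open>[0, a]\<close> is the whole strip.\<close>

lemma diameter_normalized:
  assumes "c 0 0 = R" "c a b = G" "0 \<le> a" "0 \<le> b" "2 * b \<le> n" "a + b = k" "A \<le> 0" "a \<le> B"
  shows "2 * k = 2 * (B - A) + n"
  using assms
proof (induction "nat a" arbitrary: a b rule: less_induct)
  case less
  have "odd k" using odd_normalized less.prems by blast
  \<comment> \<open>Now vertices at distance 2 are closer than \<open>k\<close>, as
    \<open>spread_G\<close> and \<open>spread_R\<close> require.\<close>
  then have k3: "3 \<le> k" using k2 by (cases "k = 2") auto
  consider "1 \<le> a" "2 * b + 2 \<le> n" | "a = 0" | "1 \<le> a" "2 * b + 1 = n" | "1 \<le> a" "2 * b = n"
    using less.prems by linarith
  then show ?case
  proof cases
    case 1
    have "cdist n 0 0 (a - 1) (b + 1) = k" "cdist n a b (a - 1) (b + 1) = 2" "cdist n 0 0 a b = k"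
      using less.prems 1 n3 by (auto simp: cdist_def cyc_eq min_def abs_if)
    then have "c (a - 1) (b + 1) = G"
      using spread_G[of 0 0 a b "a - 1" "b + 1"] k3 less.prems 1 by simp
    then show ?thesis using less.hyps[of "a - 1" "b + 1"] less.prems 1 by simp
  next
    case 2
    obtain s :: int where s: "s = 1 \<or> s = - 1" "A \<le> s" "s \<le> B"
      using AB less.prems by (cases "A \<le> - 1") (auto intro: that[of 1] that[of "-1"])
    have 1: "cdist n 0 0 s (k - 1) = k" "cdist n 0 k s (k - 1) = 2" "cdist n 0 0 0 k = k"
      "cdist n 0 k s 1 = k" "cdist n 0 0 s 1 = 2" "cdist n 0 k 0 0 = k" "cdist n s 1 s (k - 1) = k - 2"
      using less.prems 2 s n3 k3 by (auto simp: cdist_def cyc_eq min_def abs_if)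
    have "c s (k - 1) = G"
      using spread_G[of 0 0 0 k s "k - 1"] 1 k3 less.prems 2 s by simp
    moreover have "c s 1 = R"
      using spread_R[of 0 0 0 k s 1] 1 k3 less.prems 2 s by simp
    ultimately show ?thesis using kmin[of s 1 s "k - 1"] s 1 by simp
  next
    case 3
    \<comment> \<open>Rows \<open>b\<close> and \<open>b + 1\<close> are equally far from row 0, so
      either vertex can move one step around the cycle at constant distance, while moving both
      brings them closer.\<close>
    have 1: "cdist n 0 0 a (b + 1) = k" "cdist n a b a (b + 1) = 1" "cdist n 0 0 a b = k"
      "cdist n a b 0 (-1) = k" "cdist n 0 0 0 (-1) = 1" "cdist n a b 0 0 = k"
      "cdist n 0 (-1) a (b + 1) = k - 1"
      using less.prems 3 n3 k3 by (auto simp: cdist_def cyc_eq min_def abs_if)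
    have "c a (b + 1) = G"
      using spread_G[of 0 0 a b a "b + 1"] 1 k3 less.prems 3 by simp
    moreover have "c 0 (-1) = R"
      using spread_R[of 0 0 a b 0 "-1"] 1 k3 less.prems 3 by simp
    ultimately show ?thesis using kmin[of 0 "-1" a "b + 1"] less.prems 1 by simp
  next
    case 4
    have 1: "cdist n 0 0 a b = k" "cdist n a b 0 0 = k"
      "cdist n 0 0 (a + 1) (b - 1) = k" "cdist n a b (a + 1) (b - 1) = 2"
      "cdist n 0 0 (a + 1) (1 - b) = k" "cdist n a b (a + 1) (1 - b) = 2"
      "cdist n (a + 1) (b - 1) 1 (-1) = k" "cdist n (a + 1) (b - 1) 0 0 = k" "cdist n 0 0 1 (-1) = 2"
      "cdist n 1 (-1) (a + 1) (1 - b) = k - 2"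
      "cdist n a b (-1) 1 = k" "cdist n 0 0 (-1) 1 = 2"
      "cdist n a b (-1) (-1) = k" "cdist n 0 0 (-1) (-1) = 2"
      "cdist n (-1) 1 (a - 1) (b + 1) = k" "cdist n (-1) 1 a b = k" "cdist n a b (a - 1) (b + 1) = 2"
      "cdist n (-1) (-1) (a - 1) (b + 1) = k - 2"
      using less.prems 4 n3 k3 by (auto simp: cdist_def cyc_eq min_def abs_if)
    \<comment> \<open>Beyond \<open>a\<close>, both rows next to the opposite row are forced to be
      \<open>G\<close>. One of these vertices forces \<open>(1, -1)\<close> to be \<open>R\<close>,
      and the other is too close to it.\<close>
    have "a = B"
    proof (rule ccontr)
      assume "a \<noteq> B"
      then have B: "a + 1 \<le> B" using less.prems by simp
      have "c (a + 1) (b - 1) = G" "c (a + 1) (1 - b) = G"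
        using spread_G[of 0 0 a b "a + 1" "b - 1"] spread_G[of 0 0 a b "a + 1" "1 - b"]
          1 k3 less.prems B by simp_all
      moreover from this have "c 1 (-1) = R"
        using spread_R[of 0 0 "a + 1" "b - 1" 1 "-1"] 1 k3 less.prems B by simp
      ultimately have "k \<le> k - 2"
        using kmin[of 1 "-1" "a + 1" "1 - b"] 1(10) less.prems(3,7) B by simp
      then show False by simp
    qed
    moreover have "A = 0"
    proof (rule ccontr)
      assume "A \<noteq> 0"
      then have A: "A \<le> -1" using less.prems by simp
      have "c (-1) 1 = R" "c (-1) (-1) = R"
        using spread_R[of 0 0 a b "-1" 1] spread_R[of 0 0 a b "-1" "-1"]
          1 k3 less.prems A by simp_all
      moreover from this have "c (a - 1) (b + 1) = G"
        using spread_G[of "-1" 1 a b "a - 1" "b + 1"] 1(15-17) k3 less.prems(2,8) AB A 4(1) by simp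
      ultimately have "k \<le> k - 2"
        using kmin[of "-1" "-1" "a - 1" "b + 1"] 1(18) less.prems(8) AB A 4(1) by simp
      then show False by simp
    qed
    ultimately show ?thesis using less.prems(6) 4(2) by simp
  qed
qed

lemma attained:
  assumes "c x y = R" "c x' y' = G" "cdist n x y x' y' = k"
    "A \<le> x" "x \<le> B" "A \<le> x'" "x' \<le> B"
  shows "odd k" "2 * k = 2 * (B - A) + n"
proof -
  obtain d where d: "d mod n = (y' - y) mod n" "- n < 2 * d" "2 * d \<le> n"
    using cyc_rep[of n "y' - y"] n3 by auto
  have yd: "(y + d) mod n = y' mod n"
    using mod_add_cong[OF refl d(1), of y] by simp
  then have "cdist n x y x' (y + d) = k" and G: "c x' (y + d) = G"
    using assms cdist_cong[OF refl yd] c_cong[OF yd] by simp_all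
  then have xd: "\<bar>x' - x\<bar> + \<bar>d\<bar> = k"
    using d(2,3) by (simp add: cdist_def cyc_eq abs_minus_commute)
  define s t :: int where "s = (if x \<le> x' then 1 else -1)" "t = (if 0 \<le> d then 1 else -1)"
  have st: "s = 1 \<or> s = -1" "t = 1 \<or> t = -1"
    by (auto simp: s_t_def)
  define A' B' where "A' = (if s = 1 then A - x else x - B)" "B' = (if s = 1 then B - x else x - A)"
  interpret S: separated_coloring A' B' n "\<lambda>i j. c (x + s * i) (y + t * j)" R G W k
    using st by (intro transform) (auto simp: A'_B'_def)
  have *: "c (x + s * \<bar>x' - x\<bar>) (y + t * \<bar>d\<bar>) = G"
    using G by (auto simp: s_t_def abs_if)
  have r: "A' \<le> 0" "\<bar>x' - x\<bar> \<le> B'" "B' - A' = B - A"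
    using assms by (auto simp: A'_B'_def s_t_def)
  show "odd k" "2 * k = 2 * (B - A) + n"
    using S.odd_normalized[of "\<bar>x' - x\<bar>" "\<bar>d\<bar>"] S.diameter_normalized[of "\<bar>x' - x\<bar>" "\<bar>d\<bar>"]
      assms * r xd d by simp_all
qed

end

section \<open>Antipodes and the classification of colorings with three colors\<close>

lemma cyc_le: "n > 0 \<Longrightarrow> 2 * cyc n j \<le> n"
proof -
  assume "n > 0"
  then obtain j' where "j' mod n = j mod n" "- n < 2 * j'" "2 * j' \<le> n"
    using cyc_rep by blast
  then show ?thesis using cyc_cong[of j' n j] cyc_eq[of j' n] by auto
qed

text \<open>The bound is twice the diameter, so both coordinate distances to \<open>(p, q)\<close>
  are maximal: the vertex lies at the opposite end of the strip, half a cycle away.\<close>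

lemma antipode_unique:
  assumes "A < B" "3 \<le> n" "A \<le> i" "i \<le> B" "A \<le> i'" "i' \<le> B" "A \<le> p" "p \<le> B"
    and "2 * cdist n i j p q \<ge> 2 * (B - A) + n" "2 * cdist n i' j' p q \<ge> 2 * (B - A) + n"
  shows "i = i'" "j mod n = j' mod n"
proof -
  have n0: "n > 0" using assms by simp
  have *: "\<bar>i - p\<bar> = B - A" "\<bar>i' - p\<bar> = B - A" "2 * cyc n (j - q) = n" "2 * cyc n (j' - q) = n"
  proof -
    have "\<bar>i - p\<bar> \<le> B - A" "\<bar>i' - p\<bar> \<le> B - A" using assms(3-8) by (auto simp: abs_le_iff)
    moreover have "2 * \<bar>i - p\<bar> + 2 * cyc n (j - q) \<ge> 2 * (B - A) + n"
      "2 * \<bar>i' - p\<bar> + 2 * cyc n (j' - q) \<ge> 2 * (B - A) + n"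
      using assms(9,10) by (simp_all add: cdist_def)
    ultimately show "\<bar>i - p\<bar> = B - A" "\<bar>i' - p\<bar> = B - A" "2 * cyc n (j - q) = n" "2 * cyc n (j' - q) = n"
      using cyc_le[OF n0, of "j - q"] cyc_le[OF n0, of "j' - q"] by simp_all
  qed
  then show "i = i'" using assms(1,3-8) by linarith
  have half: "2 * (x mod n) = n" if "2 * cyc n x = n" for x
  proof -
    obtain z where z: "z mod n = x mod n" "- n < 2 * z" "2 * z \<le> n"
      using cyc_rep[OF n0] by blast
    then have "2 * \<bar>z\<bar> = n" using that cyc_cong[of z n x] cyc_eq[of z n] by auto
    then have "2 * z = n" using z by linarith
    then have "z mod n = z" using n0 by simp
    then show ?thesis using z \<open>2 * z = n\<close> by simp
  qed
  have "(j - q) mod n = (j' - q) mod n" using half[OF *(3)] half[OF *(4)] by linarith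
  then have "(j - q + q) mod n = (j' - q + q) mod n" by (rule mod_add_cong) simp
  then show "j mod n = j' mod n" by simp
qed

context strip_coloring
begin

text \<open>Each of the two other pairs of colors is brought to the front, where
  \<open>separated\<close> expects the non-adjacent pair.\<close>

lemma permute: "strip_coloring A B n c R W G" "strip_coloring A B n c W G R"
proof -
  show "strip_coloring A B n c R W G"
  proof unfold_locales
    show "c i j = R \<or> c i j = W \<or> c i j = G" if "A \<le> i" "i \<le> B" for i j
      using cols that by blast
    show "c i1 j1 = c i2 j2 \<or> c i2 j2 = c i3 j3 \<or> c i1 j1 = c i3 j3"
      if "cdist n i2 j2 i1 j1 = cdist n i2 j2 i3 j3" "A \<le> i1" "i1 \<le> B" "A \<le> i2" "i2 \<le> B" "A \<le> i3" "i3 \<le> B"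
      for i1 j1 i2 j2 i3 j3 using no_rainbow that by blast
  qed (use AB n3 per dst in auto)
  show "strip_coloring A B n c W G R"
  proof unfold_locales
    show "c i j = W \<or> c i j = G \<or> c i j = R" if "A \<le> i" "i \<le> B" for i j
      using cols that by blast
    show "c i1 j1 = c i2 j2 \<or> c i2 j2 = c i3 j3 \<or> c i1 j1 = c i3 j3"
      if "cdist n i2 j2 i1 j1 = cdist n i2 j2 i3 j3" "A \<le> i1" "i1 \<le> B" "A \<le> i2" "i2 \<le> B" "A \<le> i3" "i3 \<le> B"
      for i1 j1 i2 j2 i3 j3 using no_rainbow that by blast
  qed (use AB n3 per dst in auto)
qed

definition unique_color where
  "unique_color X \<longleftrightarrow> (\<forall>i j i' j'. A \<le> i \<longrightarrow> i \<le> B \<longrightarrow> A \<le> i' \<longrightarrow> i' \<le> B \<longrightarrow>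
     c i j = X \<longrightarrow> c i' j' = X \<longrightarrow> i = i' \<and> j mod n = j' mod n)"

text \<open>By \<open>attained\<close> the least distance between \<open>R\<close> and
  \<open>G\<close> is the diameter, so all such pairs are antipodal. One vertex of either color then
  determines every vertex of the other.\<close>

lemma separated:
  assumes sep: "\<And>i j i' j'. cdist n i j i' j' = 1 \<Longrightarrow> A \<le> i \<Longrightarrow> i \<le> B \<Longrightarrow> A \<le> i' \<Longrightarrow> i' \<le> B \<Longrightarrow>
      c i j = R \<Longrightarrow> c i' j' \<noteq> G"
    and R: "c x y = R" "A \<le> x" "x \<le> B" and G: "c x' y' = G" "A \<le> x'" "x' \<le> B"
  shows "(\<exists>k. odd k \<and> 2 * k = 2 * (B - A) + n) \<and> unique_color R \<and> unique_color G"
proof -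
  define Q where "Q d \<longleftrightarrow> (\<exists>i j i' j'. c i j = R \<and> c i' j' = G \<and>
    A \<le> i \<and> i \<le> B \<and> A \<le> i' \<and> i' \<le> B \<and> int d = cdist n i j i' j')" for d :: nat
  have n0: "n > 0" using n3 by simp
  have nn: "cdist n i j p q = int (nat (cdist n i j p q))" for i j p q
    using cdist_nonneg[OF n0, of i j p q] by simp
  have QI: "Q (nat (cdist n i j i' j'))"
    if "c i j = R" "c i' j' = G" "A \<le> i" "i \<le> B" "A \<le> i'" "i' \<le> B" for i j i' j'
    unfolding Q_def using that nn[of i j i' j'] by metis
  define d where "d = (LEAST d. Q d)"
  have "Q d" unfolding d_def by (rule LeastI) (rule QI[of x y x' y']; use R G in simp)
  then obtain i j i' j' where h: "c i j = R" "c i' j' = G"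
    "A \<le> i" "i \<le> B" "A \<le> i'" "i' \<le> B" and dd: "int d = cdist n i j i' j'"
    unfolding Q_def by blast
  have least: "int d \<le> cdist n i j i' j'"
    if "c i j = R" "c i' j' = G" "A \<le> i" "i \<le> B" "A \<le> i'" "i' \<le> B" for i j i' j'
  proof -
    have "d \<le> nat (cdist n i j i' j')" unfolding d_def by (rule Least_le) (rule QI[OF that])
    then show ?thesis using cdist_nonneg[OF n0, of i j i' j'] by linarith
  qed
  have "cdist n i j i' j' \<noteq> 0"
    using same_point[of i j i' j'] h dst by metis
  moreover have "cdist n i j i' j' \<noteq> 1"
    using sep[OF _ h(3-6)] h(1,2) by metis
  ultimately have d2: "2 \<le> int d" using dd by linarith
  interpret F: separated_coloring A B n c R G W "int d"
  proof unfold_locales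
    show "2 \<le> int d" by (fact d2)
    show "int d \<le> cdist n i j i' j'"
      if "c i j = R" "c i' j' = G" "A \<le> i" "i \<le> B" "A \<le> i'" "i' \<le> B" for i j i' j'
      using least that by blast
  qed
  have k: "odd (int d)" "2 * int d = 2 * (B - A) + n"
    using F.attained[of i j i' j'] h dd by simp_all
  have far: "2 * (B - A) + n \<le> 2 * cdist n i j i' j'" "2 * (B - A) + n \<le> 2 * cdist n i' j' i j"
    if "c i j = R" "c i' j' = G" "A \<le> i" "i \<le> B" "A \<le> i'" "i' \<le> B" for i j i' j'
    using least[of i j i' j'] that k cdist_sym[of n i j i' j'] by simp_all
  have "unique_color R"
    unfolding unique_color_def
  proof (intro allI impI)
    fix i j i' j'
    assume "A \<le> i" "i \<le> B" "A \<le> i'" "i' \<le> B" "c i j = R" "c i' j' = R"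
    moreover from this have "2 * (B - A) + n \<le> 2 * cdist n i j x' y'"
      "2 * (B - A) + n \<le> 2 * cdist n i' j' x' y'"
      using far(1) G by blast+
    ultimately show "i = i' \<and> j mod n = j' mod n"
      using antipode_unique[OF AB n3, of i i' x' j y' j'] G(2,3) by blast
  qed
  moreover have "unique_color G"
    unfolding unique_color_def
  proof (intro allI impI)
    fix i j i' j'
    assume "A \<le> i" "i \<le> B" "A \<le> i'" "i' \<le> B" "c i j = G" "c i' j' = G"
    moreover from this have "2 * (B - A) + n \<le> 2 * cdist n i j x y"
      "2 * (B - A) + n \<le> 2 * cdist n i' j' x y"
      using far(2) R by blast+
    ultimately show "i = i' \<and> j mod n = j' mod n"
      using antipode_unique[OF AB n3, of i i' x j y j'] R(2,3) by blast
  qed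
  ultimately show ?thesis using k by blast
qed

theorem classification:
  assumes R: "c x y = R" "A \<le> x" "x \<le> B" and G: "c x' y' = G" "A \<le> x'" "x' \<le> B"
    and W: "c x'' y'' = W" "A \<le> x''" "x'' \<le> B"
  shows "(\<exists>k. odd k \<and> 2 * k = 2 * (B - A) + n) \<and>
    (unique_color R \<and> unique_color G \<or> unique_color R \<and> unique_color W \<or> unique_color G \<and> unique_color W)"
proof -
  interpret RW: strip_coloring A B n c R W G by (rule permute)
  interpret WG: strip_coloring A B n c W G R by (rule permute)
  let ?sep = "\<lambda>X Y. \<forall>i j i' j'. cdist n i j i' j' = 1 \<longrightarrow> A \<le> i \<longrightarrow> i \<le> B \<longrightarrow> A \<le> i' \<longrightarrow> i' \<le> B \<longrightarrow>
      c i j = X \<longrightarrow> c i' j' \<noteq> Y"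
  have "?sep R G \<or> ?sep R W \<or> ?sep W G"
  proof (rule ccontr)
    assume *: "\<not> ?thesis"
    then obtain i j i' j' where "cdist n i j i' j' = 1" "A \<le> i" "i \<le> B" "A \<le> i'" "i' \<le> B"
      "c i j = R" "c i' j' = G" by blast
    moreover have "\<exists>i j p q. cdist n p q i j = 1 \<and> c i j = R \<and> c p q = W \<and>
      A \<le> i \<and> i \<le> B \<and> A \<le> p \<and> p \<le> B" using * cdist_sym by metis
    moreover have "\<exists>i j p q. cdist n p q i j = 1 \<and> c i j = G \<and> c p q = W \<and>
      A \<le> i \<and> i \<le> B \<and> A \<le> p \<and> p \<le> B" using * by blast
    ultimately show False using not_all_adjacent by blast
  qed
  then show ?thesis
    using separated[OF _ R G] RW.separated[OF _ R W] WG.separated[OF _ W G] by blast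
qed

end

section \<open>Distances in the cylinder and its colorings\<close>

text \<open>A potential argument: \<open>d\<close> drops by at most 1 per arc, which bounds the
  length of walks from below, and \<open>descent\<close> builds a walk of exactly that
  length.\<close>

lemma gdist_eqI:
  fixes d :: "'a \<Rightarrow> nat"
  assumes G: "pair_graph G" and u: "u \<in> pverts G" and v: "v \<in> pverts G"
    and zero: "\<And>u. u \<in> pverts G \<Longrightarrow> d u = 0 \<longleftrightarrow> u = v"
    and lipschitz: "\<And>u w. (u, w) \<in> parcs G \<Longrightarrow> d u \<le> d w + 1"
    and descent: "\<And>u. u \<in> pverts G \<Longrightarrow> 0 < d u \<Longrightarrow> \<exists>w. (u, w) \<in> parcs G \<and> d u = d w + 1"
  shows "gdist G u v = ereal (real (d u))"
proof -
  interpret pair_graph G by fact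
  have cost: "awalk_cost (\<lambda>_. 1) p = real (length p)" for p
    by (simp add: awalk_cost_def sum_list_triv)
  have lower: "d u \<le> length p" if "awalk u p v" for u p
    using that
  proof (induction p arbitrary: u)
    case Nil
    then show ?case using zero[of v] by (auto simp: awalk_Nil_iff)
  next
    case (Cons e p)
    then have e: "e \<in> parcs G" "u = fst e" "awalk (snd e) p v" by (auto simp: awalk_Cons_iff)
    then have "d u \<le> d (snd e) + 1" using lipschitz[of u "snd e"] by simp
    then show ?case using Cons.IH[OF e(3)] by simp
  qed
  have upper: "\<exists>p. awalk u p v \<and> length p = d u" if "u \<in> pverts G" for u
    using that
  proof (induction "d u" arbitrary: u)
    case 0
    then have "u = v" using zero by metis
    then show ?case using 0 by (intro exI[of _ "[]"]) (simp add: awalk_Nil_iff)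
  next
    case (Suc k)
    then obtain w where w: "(u, w) \<in> parcs G" "d u = d w + 1" using descent[of u] by auto
    moreover have "w \<in> pverts G" using w(1) in_arcsD2 by blast
    ultimately obtain p where "awalk w p v" "length p = d w" using Suc by auto
    then show ?case using w by (intro exI[of _ "(u, w) # p"]) (simp add: awalk_Cons_iff)
  qed
  obtain p where p: "awalk u p v" "length p = d u" using upper u by blast
  show ?thesis
    unfolding gdist_def \<mu>_def
  proof (rule antisym)
    show "(INF p\<in>{p. awalk u p v}. ereal (awalk_cost (\<lambda>_. 1) p)) \<le> ereal (real (d u))"
      using p by (intro INF_lower2[of p]) (auto simp: cost)
    show "ereal (real (d u)) \<le> (INF p\<in>{p. awalk u p v}. ereal (awalk_cost (\<lambda>_. 1) p))"
      using lower by (intro INF_greatest) (auto simp: cost)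
  qed
qed

section \<open>General facts on exact colorings and \<open>aw3\<close>\<close>

lemma exact_coloring_exists:
  assumes "finite (pverts G)" "0 < r" "r \<le> card (pverts G)"
  shows "\<exists>c. exact_coloring G r c"
proof -
  obtain h where h: "bij_betw h (pverts G) {0..<card (pverts G)}"
    using ex_bij_betw_finite_nat assms by blast
  \<comment> \<open>The first \<open>r - 1\<close> vertices receive colors of their own, and all
    others share the color \<open>r\<close>.\<close>
  have "(\<lambda>v. min (Suc (h v)) r) ` pverts G = (\<lambda>i. min (Suc i) r) ` (h ` pverts G)"
    by (simp add: image_image)
  also have "\<dots> = (\<lambda>i. min (Suc i) r) ` {0..<card (pverts G)}"
    using h by (simp add: bij_betw_def)
  also have "\<dots> = {1..r}"
  proof
    show "{1..r} \<subseteq> (\<lambda>i. min (Suc i) r) ` {0..<card (pverts G)}"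
    proof
      fix i assume "i \<in> {1..r}"
      then show "i \<in> (\<lambda>i. min (Suc i) r) ` {0..<card (pverts G)}"
        using assms by (intro image_eqI[of _ _ "i - 1"]) auto
    qed
  qed (use assms in auto)
  finally show ?thesis unfolding exact_coloring_def by blast
qed

lemma no_rainbow_3AP_few_colors:
  assumes "exact_coloring G r c" "r < 3"
  shows "\<not> has_rainbow_3AP G c"
proof
  assume "has_rainbow_3AP G c"
  then obtain S where S: "is_3AP G S" "inj_on c S" by (auto simp: has_rainbow_3AP_def rainbow_def)
  then have "card S = 3" "S \<subseteq> pverts G" by (auto simp: is_3AP_def)
  then have "card (c ` S) = 3" "c ` S \<subseteq> {1..r}"
    using S assms by (auto simp: card_image exact_coloring_def)
  then have "3 \<le> card {1..r}" by (metis card_mono finite_atLeastAtMost)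
  then show False using assms by simp
qed

text \<open>Merging colors cannot create a rainbow progression; this reduces four colors to
  three.\<close>

lemma has_rainbow_3AP_comp:
  assumes "has_rainbow_3AP G (f \<circ> c)"
  shows "has_rainbow_3AP G c"
  using assms unfolding has_rainbow_3AP_def rainbow_def by (meson inj_on_imageI2)

text \<open>The bound by the number of vertices provides an exact coloring with \<open>r\<close>
  colors, so \<open>all\<close> is not vacuous and the \<open>LEAST\<close> branch of
  \<open>aw3\<close> is taken.\<close>

lemma aw3_eqI:
  assumes "finite (pverts G)" "0 < r" "r \<le> card (pverts G)"
    and all: "\<And>c. exact_coloring G r c \<Longrightarrow> has_rainbow_3AP G c"
    and below: "\<And>r'. 0 < r' \<Longrightarrow> r' < r \<Longrightarrow> \<exists>c. exact_coloring G r' c \<and> \<not> has_rainbow_3AP G c"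
  shows "aw3 G = r"
proof -
  have "\<exists>r c. exact_coloring G r c \<and> has_rainbow_3AP G c"
    using exact_coloring_exists[OF assms(1-3)] all by blast
  moreover have "(LEAST r. 0 < r \<and> (\<forall>c. exact_coloring G r c \<longrightarrow> has_rainbow_3AP G c)) = r"
    using assms(2) all below by (intro Least_equality) (auto simp: not_less[symmetric])
  ultimately show ?thesis by (simp add: aw3_def)
qed

section \<open>Distance and diameter of the cylinder\<close>

fun grid_dist :: "nat \<Rightarrow> nat \<times> nat \<Rightarrow> nat \<times> nat \<Rightarrow> nat" where
  "grid_dist n (x, y) (x', y') = nat (cdist (int n) (int x) (int y) (int x') (int y'))"

abbreviation grid :: "nat \<Rightarrow> nat \<Rightarrow> (nat \<times> nat) pair_pre_digraph" where
  "grid m n \<equiv> path_graph m \<box> cycle_graph n"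

lemma pverts_grid: "pverts (grid m n) = {..<m} \<times> {..<n}"
  by (simp add: cart_prod_def path_graph_def cycle_graph_def)

lemma parcs_grid: "((x, y), (x', y')) \<in> parcs (grid m n) \<longleftrightarrow>
    x < m \<and> x = x' \<and> y < n \<and> y' < n \<and> (y' = (y + 1) mod n \<or> y = (y' + 1) mod n) \<or>
    y < n \<and> y = y' \<and> x < m \<and> x' < m \<and> (x' = x + 1 \<or> x = x' + 1)"
  by (auto simp: cart_prod_def path_graph_def cycle_graph_def)

lemma int_grid_dist:
  assumes "n \<ge> 3"
  shows "int (grid_dist n (x, y) (x', y')) = cdist (int n) (int x) (int y) (int x') (int y')"
  using cdist_nonneg[of "int n"] assms by simp

declare grid_dist.simps [simp del]

lemma grid_dist_sym: "grid_dist n u v = grid_dist n v u"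
  by (cases u; cases v) (simp add: grid_dist.simps cdist_sym)

lemma cyc_Suc:
  assumes "n \<ge> 3"
  shows "cyc n (j + 1) \<le> cyc n j + 1" "cyc n j \<le> cyc n (j + 1) + 1"
proof -
  obtain z where z: "z mod n = j mod n" "- n < 2 * z" "2 * z \<le> n"
    using cyc_rep[of n j] assms by auto
  have "(z + 1) mod n = (j + 1) mod n" using mod_add_cong[OF z(1) refl] .
  then have "cyc n (j + 1) = cyc n (z + 1)" "cyc n j = cyc n z"
    using z(1) cyc_cong by metis+
  then show "cyc n (j + 1) \<le> cyc n j + 1" "cyc n j \<le> cyc n (j + 1) + 1"
    using z(2,3) assms by (auto simp: cyc_eq)
qed

lemma gdist_grid:
  assumes n: "n \<ge> 3" and u: "u \<in> pverts (grid m n)" and v: "v \<in> pverts (grid m n)"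
  shows "gdist (grid m n) u v = ereal (real (grid_dist n u v))"
proof (rule gdist_eqI[OF _ u v])
  show "pair_graph (grid m n)"
    using n by (intro pair_graph_cart_prod pair_graph_path_graph pair_graph_cycle_graph)
  obtain x' y' where v': "v = (x', y')" "x' < m" "y' < n"
    using v by (auto simp: pverts_grid)
  show "grid_dist n u v = 0 \<longleftrightarrow> u = v" if u_in: "u \<in> pverts (grid m n)" for u
  proof -
    obtain x y where u': "u = (x, y)" "x < m" "y < n"
      using u_in by (auto simp: pverts_grid)
    have "u = v" if "grid_dist n u v = 0"
    proof -
      have "cdist (int n) (int x) (int y) (int x') (int y') = 0"
        using int_grid_dist[OF n, of x y x' y'] that u' v' by simp
      then show ?thesis using cdist_eq_0D[of "int n" x y x' y'] u' v' by simp
    qed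
    moreover have "grid_dist n v v = 0" by (simp add: v' grid_dist.simps cdist_def cyc_def)
    ultimately show ?thesis by blast
  qed
  show "grid_dist n u v \<le> grid_dist n w v + 1" if "(u, w) \<in> parcs (grid m n)" for u w
  proof -
    obtain x y z t where uw: "u = (x, y)" "w = (z, t)" by (cases u; cases w)
    have "cdist (int n) x y x' y' \<le> cdist (int n) z t x' y' + 1"
    proof (cases "x = z")
      case False
      then show ?thesis using that by (auto simp: uw parcs_grid cdist_def)
    next
      case True
      have "t = (y + 1) mod n \<or> y = (t + 1) mod n" using that True by (auto simp: uw parcs_grid)
      then consider "int t = (int y + 1) mod int n" | "int y = (int t + 1) mod int n"
        by (auto simp: of_nat_mod add.commute)
      then show ?thesis
      proof cases
        case 1
        have "cyc (int n) (int t - int y') = cyc (int n) ((int y - int y') + 1)"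
          by (rule cyc_cong) (simp add: 1 mod_diff_left_eq algebra_simps)
        then show ?thesis using True cyc_Suc[of "int n" "int y - int y'"] n by (simp add: cdist_def)
      next
        case 2
        have "cyc (int n) (int y - int y') = cyc (int n) ((int t - int y') + 1)"
          by (rule cyc_cong) (simp add: 2 mod_diff_left_eq algebra_simps)
        then show ?thesis using True cyc_Suc[of "int n" "int t - int y'"] n by (simp add: cdist_def)
      qed
    qed
    then have "int (grid_dist n u v) \<le> int (grid_dist n w v) + 1"
      unfolding uw v' by (simp only: int_grid_dist[OF n])
    then show ?thesis by simp
  qed
  show "\<exists>w. (u, w) \<in> parcs (grid m n) \<and> grid_dist n u v = grid_dist n w v + 1"
    if u_in: "u \<in> pverts (grid m n)" and u_pos: "0 < grid_dist n u v" for u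
  proof -
    obtain x y where u': "u = (x, y)" "x < m" "y < n"
      using u_in by (auto simp: pverts_grid)
    have lift: "\<exists>w. (u, w) \<in> parcs (grid m n) \<and> grid_dist n u v = grid_dist n w v + 1"
      if "((x, y), (z, t)) \<in> parcs (grid m n)"
        "cdist (int n) x y x' y' = cdist (int n) z t x' y' + 1" for z t
    proof -
      have "int (grid_dist n u v) = int (grid_dist n (z, t) v) + 1"
        using that(2) unfolding u' v' by (simp only: int_grid_dist[OF n])
      then show ?thesis using that(1) u' by (intro exI[of _ "(z, t)"]) simp
    qed
    \<comment> \<open>The descent moves along the path while the first coordinates differ, and
      otherwise around the cycle in the direction given by the sign of \<open>d\<close>.\<close>
    consider "x < x'" | "x' < x" | "x = x'" by linarith
    then show ?thesis
    proof cases
      case 1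
      then show ?thesis using u' v' by (intro lift[of "x + 1" y]) (auto simp: parcs_grid cdist_def)
    next
      case 2
      then show ?thesis using u' v' by (intro lift[of "x - 1" y]) (auto simp: parcs_grid cdist_def)
    next
      case 3
      have "0 < cdist (int n) x y x' y'"
        using u_pos unfolding u' v' by (metis int_grid_dist n of_nat_0_less_iff)
      then have pos: "0 < cyc (int n) (int y - int y')" using 3 by (simp add: cdist_def)
      obtain d where d: "d mod int n = (int y - int y') mod int n" "- int n < 2 * d" "2 * d \<le> int n"
        using cyc_rep[of "int n"] n by auto
      have abs: "cyc (int n) (int y - int y') = \<bar>d\<bar>"
        using cyc_cong[OF d(1)] d(2,3) by (simp add: cyc_eq)
      show ?thesis
      proof (cases "d > 0")
        case True
        \<comment> \<open>Adding \<open>n - 1\<close> subtracts 1 modulo \<open>n\<close> within the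
          natural numbers.\<close>
        define t where "t = (y + (n - 1)) mod n"
        have t: "int t = (int y - 1) mod int n"
          using n by (simp add: t_def of_nat_mod of_nat_diff) (metis add_diff_eq diff_add_eq mod_add_self2)
        have "(t + 1) mod n = (y + n) mod n"
          using n by (simp add: t_def mod_Suc_eq)
        then have arc: "y = (t + 1) mod n" "t < n" using u' n by (simp_all add: t_def)
        have "cyc (int n) (int t - int y') = cyc (int n) (d - 1)"
        proof (rule cyc_cong)
          have "(int t - int y') mod int n = ((int y - int y') - 1) mod int n"
            by (simp add: t mod_diff_left_eq algebra_simps)
          also have "\<dots> = (d - 1) mod int n" using mod_diff_cong[OF d(1) refl] by simp
          finally show "(int t - int y') mod int n = (d - 1) mod int n" .
        qed
        then have "cyc (int n) (int t - int y') = \<bar>d\<bar> - 1"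
          using d(2,3) True by (simp add: cyc_eq)
        then show ?thesis
          using abs arc 3 u' by (intro lift[of x t]) (auto simp: parcs_grid cdist_def)
      next
        case False
        then have neg: "d < 0" using pos abs by linarith
        define t where "t = (y + 1) mod n"
        have t: "int t = (int y + 1) mod int n" by (simp add: t_def of_nat_mod add.commute)
        have arc: "t = (y + 1) mod n" "t < n" using n by (simp_all add: t_def)
        have "cyc (int n) (int t - int y') = cyc (int n) (d + 1)"
        proof (rule cyc_cong)
          have "(int t - int y') mod int n = ((int y - int y') + 1) mod int n"
            by (simp add: t mod_diff_left_eq algebra_simps)
          also have "\<dots> = (d + 1) mod int n" using mod_add_cong[OF d(1) refl] by simp
          finally show "(int t - int y') mod int n = (d + 1) mod int n" .
        qed
        then have "cyc (int n) (int t - int y') = \<bar>d\<bar> - 1"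
          using d(2,3) neg by (simp add: cyc_eq)
        then show ?thesis
          using abs arc 3 u' by (intro lift[of x t]) (auto simp: parcs_grid cdist_def)
      qed
    qed
  qed
qed

lemma diam_grid:
  assumes "m \<ge> 1" "n \<ge> 3"
  shows "diam (grid m n) = ereal (real (m - 1 + n div 2))"
proof (rule antisym)
  show "diam (grid m n) \<le> ereal (real (m - 1 + n div 2))"
    unfolding diam_def
  proof (rule SUP_least, clarify)
    fix x y x' y' assume v: "(x, y) \<in> pverts (grid m n)" "(x', y') \<in> pverts (grid m n)"
    have "\<bar>int x - int x'\<bar> \<le> int m - 1" using v by (auto simp: pverts_grid)
    moreover have "2 * cyc (int n) (int y - int y') \<le> int n" using cyc_le assms by simp
    ultimately have "cdist (int n) x y x' y' \<le> int m - 1 + int n div 2"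
      by (simp add: cdist_def)
    then have "int (grid_dist n (x, y) (x', y')) \<le> int (m - 1 + n div 2)"
      using int_grid_dist[OF assms(2)] assms(1) by (simp add: of_nat_diff zdiv_int)
    then show "gdist (grid m n) (x, y) (x', y') \<le> ereal (real (m - 1 + n div 2))"
      unfolding gdist_grid[OF assms(2) v] ereal_less_eq of_nat_le_iff by linarith
  qed
  have v: "(0, 0) \<in> pverts (grid m n)" "(m - 1, n div 2) \<in> pverts (grid m n)"
    using assms by (auto simp: pverts_grid)
  have "int (grid_dist n (0, 0) (m - 1, n div 2)) = int (m - 1 + n div 2)"
    unfolding int_grid_dist[OF assms(2)] using assms by (auto simp: cdist_def cyc_eq)
  then show "ereal (real (m - 1 + n div 2)) \<le> diam (grid m n)"
    unfolding diam_def using v gdist_grid[OF assms(2) v]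
    by (intro SUP_upper2[of "((0, 0), (m - 1, n div 2))"]) auto
qed

section \<open>Colorings of the cylinder with three and four colors\<close>

definition unique_in :: "('a \<Rightarrow> nat) \<Rightarrow> 'a set \<Rightarrow> nat \<Rightarrow> bool" where
  "unique_in c V X \<longleftrightarrow> (\<forall>u\<in>V. \<forall>v\<in>V. c u = X \<longrightarrow> c v = X \<longrightarrow> u = v)"

text \<open>The map \<open>?p\<close> rolls the strip \<open>[0, m - 1]\<close> up onto the cylinder
  and preserves distances, so \<open>classification\<close> carries over; the \<open>k\<close> it
  provides is the diameter.\<close>

lemma grid_three_colors:
  assumes mn: "m \<ge> 2" "n \<ge> 3" and c: "exact_coloring (grid m n) 3 c" "\<not> has_rainbow_3AP (grid m n) c"
  shows "even n \<and> odd (m - 1 + n div 2)"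
    and "unique_in c (pverts (grid m n)) 1 \<and> unique_in c (pverts (grid m n)) 2 \<or>
      unique_in c (pverts (grid m n)) 1 \<and> unique_in c (pverts (grid m n)) 3 \<or>
      unique_in c (pverts (grid m n)) 2 \<and> unique_in c (pverts (grid m n)) 3"
proof -
  let ?V = "pverts (grid m n)"
  let ?A = "0 :: int" and ?B = "int m - 1" and ?n = "int n"
  let ?p = "\<lambda>i j. (nat i, nat (j mod int n))"
  let ?c = "\<lambda>i j. c (?p i j)"
  have V: "?p i j \<in> ?V" if "0 \<le> i" "i \<le> int m - 1" for i j
    using that mn by (auto simp: pverts_grid nat_less_iff)
  have img: "c ` ?V = {1, 2, 3}"
    using c(1) by (auto simp: exact_coloring_def)
  have dist: "int (grid_dist n (?p i j) (?p i' j')) = cdist ?n i j i' j'"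
    if "0 \<le> i" "i \<le> int m - 1" "0 \<le> i'" "i' \<le> int m - 1" for i j i' j'
    unfolding int_grid_dist[OF mn(2)] using that mn
    by (simp add: cdist_cong[of "j mod ?n" ?n j "j' mod ?n" j'])
  interpret S: strip_coloring ?A ?B ?n ?c 1 2 3
  proof unfold_locales
    show "?A < ?B" "3 \<le> ?n" using mn by auto
    show "?c i (j mod ?n) = ?c i j" for i j by simp
    show "?c i j = 1 \<or> ?c i j = 2 \<or> ?c i j = 3" if "?A \<le> i" "i \<le> ?B" for i j
      using V[OF that] img by blast
    show "(1::nat) \<noteq> 2" "(1::nat) \<noteq> 3" "(2::nat) \<noteq> 3" by auto
    fix i1 j1 i2 j2 i3 j3
    assume h: "cdist ?n i2 j2 i1 j1 = cdist ?n i2 j2 i3 j3"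
      and r: "?A \<le> i1" "i1 \<le> ?B" "?A \<le> i2" "i2 \<le> ?B" "?A \<le> i3" "i3 \<le> ?B"
    let ?u = "?p i1 j1" and ?v = "?p i2 j2" and ?w = "?p i3 j3"
    have "int (grid_dist n ?u ?v) = int (grid_dist n ?v ?w)"
      using h r cdist_sym[of ?n i1 j1] by (simp only: dist)
    then have eq: "gdist (grid m n) ?u ?v = gdist (grid m n) ?v ?w"
      using gdist_grid[OF mn(2) V V] r by simp
    show "?c i1 j1 = ?c i2 j2 \<or> ?c i2 j2 = ?c i3 j3 \<or> ?c i1 j1 = ?c i3 j3"
    proof (rule ccontr)
      \<comment> \<open>Different colors make the three vertices distinct, as \<open>is_3AP\<close>
        requires.\<close>
      assume neq: "\<not> ?thesis"
      then have "distinct [?u, ?v, ?w]" "inj_on c {?u, ?v, ?w}"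
        by (auto simp: inj_on_def)
      then have "is_3AP (grid m n) {?u, ?v, ?w}" "rainbow c {?u, ?v, ?w}"
        using eq V r unfolding is_3AP_def rainbow_def by blast+
      then show False using c(2) unfolding has_rainbow_3AP_def by blast
    qed
  qed
  have preimage: "\<exists>x y. 0 \<le> x \<and> x \<le> ?B \<and> u = ?p x y" if "u \<in> ?V" for u
    using that by (intro exI[of _ "int (fst u)"] exI[of _ "int (snd u)"]) (auto simp: pverts_grid)
  have occurs: "\<exists>x y. ?c x y = X \<and> 0 \<le> x \<and> x \<le> ?B" if X: "X \<in> {1, 2, 3}" for X
  proof -
    obtain u where "u \<in> ?V" "c u = X" using X img by (metis imageE)
    then show ?thesis using preimage[of u] by blast
  qed
  have unique: "unique_in c ?V X" if "S.unique_color X" for X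
    unfolding unique_in_def
  proof (intro ballI impI)
    fix u v assume uv: "u \<in> ?V" "v \<in> ?V" "c u = X" "c v = X"
    obtain x y where u: "0 \<le> x" "x \<le> ?B" "u = ?p x y" using preimage[OF uv(1)] by blast
    obtain x' y' where v: "0 \<le> x'" "x' \<le> ?B" "v = ?p x' y'" using preimage[OF uv(2)] by blast
    have "x = x' \<and> y mod ?n = y' mod ?n"
      using that[unfolded S.unique_color_def, rule_format, of x x' y y'] u v uv by blast
    then show "u = v" using u v by simp
  qed
  obtain x y x' y' x'' y'' where "?c x y = 1" "0 \<le> x" "x \<le> ?B"
    "?c x' y' = 2" "0 \<le> x'" "x' \<le> ?B" "?c x'' y'' = 3" "0 \<le> x''" "x'' \<le> ?B"
    using occurs[of 1] occurs[of 2] occurs[of 3] by auto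
  note cl = S.classification[OF this]
  then obtain k :: int where k: "odd k" "2 * k = 2 * (int m - 1) + int n" by auto
  have "even (int n)" using k(2) by presburger
  then have "even n" by simp
  then obtain h where h: "n = 2 * h" by blast
  then have "k = int (m - 1 + n div 2)" using k(2) mn by simp
  then show "even n \<and> odd (m - 1 + n div 2)" using k(1) \<open>even n\<close> by (metis even_of_nat)
  show "unique_in c ?V 1 \<and> unique_in c ?V 2 \<or> unique_in c ?V 1 \<and> unique_in c ?V 3 \<or>
      unique_in c ?V 2 \<and> unique_in c ?V 3"
    using cl unique by blast
qed

text \<open>A merged color occurs at least twice, so \<open>grid_three_colors\<close> makes the
  other two unique. Two disjoint merges make all four unique, which leaves only four vertices
  instead of at least six.\<close>

lemma grid_four_colors:
  assumes mn: "m \<ge> 2" "n \<ge> 3" and c: "exact_coloring (grid m n) 4 c"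
  shows "has_rainbow_3AP (grid m n) c"
proof (rule ccontr)
  assume no: "\<not> ?thesis"
  let ?V = "pverts (grid m n)"
  have img: "c ` ?V = {1, 2, 3, 4}" using c by (auto simp: exact_coloring_def)
  have "\<exists>v\<in>?V. c v = i" if "i \<in> {1, 2, 3, 4}" for i
    using that unfolding img[symmetric] by blast
  from this[of 1] this[of 2] this[of 3] this[of 4]
  obtain v1 v2 v3 v4 where v: "v1 \<in> ?V" "c v1 = 1" "v2 \<in> ?V" "c v2 = 2" "v3 \<in> ?V" "c v3 = 3"
    "v4 \<in> ?V" "c v4 = 4"
    by auto
  have merge: "unique_in (f \<circ> c) ?V 1 \<and> unique_in (f \<circ> c) ?V 2 \<or>
      unique_in (f \<circ> c) ?V 1 \<and> unique_in (f \<circ> c) ?V 3 \<or>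
      unique_in (f \<circ> c) ?V 2 \<and> unique_in (f \<circ> c) ?V 3" if "f ` {1, 2, 3, 4} = {1, 2, 3}" for f
  proof -
    have "(f \<circ> c) ` ?V = {1..3}" using that img unfolding image_comp[symmetric] by auto
    then show ?thesis
      using grid_three_colors(2)[OF mn, of "f \<circ> c"] no has_rainbow_3AP_comp
      unfolding exact_coloring_def by blast
  qed
  \<comment> \<open>The merged color is 3 in both cases: \<open>f\<close> merges 3 and 4, while
    \<open>g\<close> merges 1 and 2 and renames 3 and 4 to 1 and 2.\<close>
  define f g :: "nat \<Rightarrow> nat" where "f i = (if i = 4 then 3 else i)" "g i = (if i \<le> 2 then 3 else i - 2)" for i
  have "\<not> unique_in (f \<circ> c) ?V 3" "\<not> unique_in (g \<circ> c) ?V 3"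
    using v unfolding unique_in_def f_g_def by force+
  moreover have "f ` {1, 2, 3, 4} = {1, 2, 3}" "g ` {1, 2, 3, 4} = {1, 2, 3}"
    by (auto simp: f_g_def)
  ultimately have u: "unique_in (f \<circ> c) ?V 1" "unique_in (f \<circ> c) ?V 2"
    "unique_in (g \<circ> c) ?V 1" "unique_in (g \<circ> c) ?V 2"
    using merge by blast+
  have "inj_on c ?V"
  proof (rule inj_onI)
    fix a b assume ab: "a \<in> ?V" "b \<in> ?V" "c a = c b"
    then have "c a \<in> {1, 2, 3, 4}" using img by blast
    then show "a = b"
      using u[unfolded unique_in_def, rule_format, OF ab(1,2)] ab(3) by (auto simp: f_g_def)
  qed
  then have "card ?V = 4" using card_image[of c ?V] img by simp
  moreover have "2 * 3 \<le> m * n" using mn by (intro mult_le_mono)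
  ultimately show False by (simp add: pverts_grid card_cartesian_product)
qed

text \<open>For even \<open>n\<close>, every vertex lies on a geodesic between the antipodes
  \<open>u\<close> and \<open>v\<close>. A rainbow progression contains both: centered at one of
  them it would need a second antipode, and centered elsewhere it would halve the odd
  diameter.\<close>

lemma grid_antipodal_coloring:
  assumes mn: "m \<ge> 2" "n \<ge> 3" and n: "even n" and D: "odd (m - 1 + n div 2)"
  shows "\<exists>c. exact_coloring (grid m n) 3 c \<and> \<not> has_rainbow_3AP (grid m n) c"
proof -
  let ?V = "pverts (grid m n)"
  let ?d = "grid_dist n"
  define u v where "u = (0::nat, 0::nat)" "v = (m - 1, n div 2)"
  define c where "c w = (if w = u then 1 else if w = v then 2 else 3 :: nat)" for w
  have uv: "u \<in> ?V" "v \<in> ?V" "u \<noteq> v" using mn by (auto simp: u_v_def pverts_grid)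
  have "(0, 1) \<in> ?V" "c (0, 1) = 3" "c u = 1" "c v = 2"
    using mn uv by (auto simp: u_v_def c_def pverts_grid)
  then have "c ` ?V = {1, 2, 3}"
    using uv by (auto simp: c_def image_iff split: if_splits)
  then have exact: "exact_coloring (grid m n) 3 c" by (auto simp: exact_coloring_def)
  have sum: "?d u w + ?d w v = m - 1 + n div 2" if w_in: "w \<in> ?V" for w
  proof -
    obtain x y where w: "w = (x, y)" "x < m" "y < n" using w_in by (auto simp: pverts_grid)
    obtain h where h: "n = 2 * h" using n by blast
    have "int (?d u w + ?d w v) = int (m - 1 + n div 2)"
      unfolding w u_v_def of_nat_add int_grid_dist[OF mn(2)]
      using w h mn by (auto simp: cdist_def cyc_eq)
    then show ?thesis by linarith
  qed
  have zero: "a = b" if a0: "?d a b = 0" "a \<in> ?V" "b \<in> ?V" for a b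
  proof -
    obtain x y x' y' where ab: "a = (x, y)" "b = (x', y')" "y < n" "y' < n"
      using a0 by (auto simp: pverts_grid)
    then have "cdist (int n) x y x' y' = 0"
      using int_grid_dist[OF mn(2), of x y x' y'] a0 by simp
    then show ?thesis using cdist_eq_0D[of "int n" x y x' y'] ab by simp
  qed
  have duv: "?d u v = m - 1 + n div 2" using sum[OF uv(1)] by (simp add: u_v_def grid_dist.simps cdist_def cyc_def)
  have "\<not> has_rainbow_3AP (grid m n) c"
  proof
    assume "has_rainbow_3AP (grid m n) c"
    then obtain a b e where S: "{a, b, e} \<subseteq> ?V" "distinct [a, b, e]" "inj_on c {a, b, e}"
      and eq: "gdist (grid m n) a b = gdist (grid m n) b e"
      unfolding has_rainbow_3AP_def rainbow_def is_3AP_def by blast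
    have d: "?d a b = ?d b e"
      using eq S(1) gdist_grid[OF mn(2)] by simp
    have ne: "c a \<noteq> c b" "c b \<noteq> c e" "c a \<noteq> c e" using S(2,3) by (auto simp: inj_on_def)
    consider "b = u" "a = v \<or> e = v" | "b = v" "a = u \<or> e = u" | "a = u" "e = v" | "a = v" "e = u"
      using ne by (auto simp: c_def split: if_splits)
    then show False
    proof cases
      case 1
      then show False
        using d duv sum[of a] sum[of e] zero[of a v] zero[of e v] S uv grid_dist_sym[of n a b] by auto
    next
      case 2
      then show False
        using d duv sum[of a] sum[of e] zero[of u a] zero[of u e] S uv grid_dist_sym[of n]
        by (metis add_cancel_right_left distinct_length_2_or_more insert_subset)
    next
      case 3
      then have "?d u b + ?d u b = m - 1 + n div 2" using d sum[of b] S by simp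
      then show False using D by (metis even_add)
    next
      case 4
      then have "?d u b + ?d u b = m - 1 + n div 2"
        using d sum[of b] S(1) grid_dist_sym[of n b u] grid_dist_sym[of n v b] by simp
      then show False using D by (metis even_add)
    qed
  qed
  then show ?thesis using exact by blast
qed

theorem theorem5:
  fixes m n :: nat
  assumes "m \<ge> 2" and "n \<ge> 3"
  shows "aw3 (path_graph m \<box> cycle_graph n) =
    (if even n \<and> (\<exists>k::nat. odd k \<and> diam (path_graph m \<box> cycle_graph n) = ereal (real k))
     then 4 else 3)"
proof -
  have fin: "finite (pverts (grid m n))" by (simp add: pverts_grid)
  have "2 * 3 \<le> m * n" using assms by (intro mult_le_mono)
  then have card: "6 \<le> card (pverts (grid m n))" by (simp add: pverts_grid card_cartesian_product)
  have few: "\<exists>c. exact_coloring (grid m n) r c \<and> \<not> has_rainbow_3AP (grid m n) c" if "0 < r" "r < 3" for r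
    using exact_coloring_exists[OF fin, of r] no_rainbow_3AP_few_colors that card by fastforce
  \<comment> \<open>As \<open>diam\<close> is an extended real, its parity is expressed through a
    natural number, which \<open>diam_grid\<close> identifies.\<close>
  have diam: "(\<exists>k::nat. odd k \<and> diam (grid m n) = ereal (real k)) \<longleftrightarrow> odd (m - 1 + n div 2)"
  proof -
    define K where "K = m - 1 + n div 2"
    have "diam (grid m n) = ereal (real K)" unfolding K_def by (rule diam_grid) (use assms in auto)
    then show ?thesis unfolding K_def[symmetric] by simp
  qed
  show ?thesis
  proof (cases "even n \<and> odd (m - 1 + n div 2)")
    case True
    have "aw3 (grid m n) = 4"
    proof (rule aw3_eqI[OF fin])
      show "\<exists>c. exact_coloring (grid m n) r c \<and> \<not> has_rainbow_3AP (grid m n) c" if "0 < r" "r < 4" for r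
        using that few[of r] grid_antipodal_coloring[OF assms] True by (cases "r = 3") auto
    qed (use card grid_four_colors assms in auto)
    then show ?thesis using True diam by simp
  next
    case False
    have "aw3 (grid m n) = 3"
      using card grid_three_colors(1)[OF assms] False few by (intro aw3_eqI[OF fin]) auto
    then show ?thesis using False diam by auto
  qed
qed

end
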